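(* Let $N\in\mathbb N$, $\alpha\in(0,N)$, $p\ge1$ and $W:\mathbb R^N\to\mathbb R$. If for every $u\in E^{\alpha,p}(\mathbb R^N)$ $$\int_{\mathbb R^N}W|u|^p\le\Bigl(\int_{\mathbb R^N}\bigl|I_{\alpha/2}*|u|^p\bigr|^2\Bigr)^{\frac12},$$ then for any $\delta>\frac12$, $$\int_{\mathbb R^N}\frac{W(x)}{|x|^{\frac{N+\alpha}2}\bigl(1+|\log|x||\bigr)^{\frac12}\bigl(1+\log(1+|\log|x||)\bigr)^\delta}\,\mathrm dx<\infty.$$
   Context: $\mathbb N$ denotes the positive integers. For $\alpha\in(0,N)$ the Riesz potential is $I_\alpha(x)=A_\alpha|x|^{-(N-\alpha)}$ for $x\in\mathbb R^N\setminus\{0\}$, with $A_\alpha=\frac{\Gamma((N-\alpha)/2)}{\Gamma(\alpha/2)\pi^{N/2}2^\alpha}$. For $p\ge1$, the Coulomb--Sobolev space $E^{\alpha,p}(\mathbb R^N)$ is the vector space of measurable functions $u:\mathbb R^N\to\mathbb R$ with $\int_{\mathbb R^N}|I_{\alpha/2}*|u|^p|^2<\infty$ that are weakly differentiable with $Du\in L^2(\mathbb R^N)$. The function $W$ plays the role of a weight. *)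

theory Defs
  imports "HOL-Analysis.Analysis"
begin

text \<open>
  Throughout, the space \<open>\<real>\<^sup>N\<close> is a Euclidean space \<open>'a\<close> with \<open>N = DIM('a)\<close>, and integrals are
  with respect to the (completed) Lebesgue measure.
\<close>

text \<open>\<open>|x|\<^sup>-\<^sup>(\<^sup>N\<^sup>-\<^sup>a\<^sup>)\<close> at \<open>x = 0\<close> is outside the domain of \<open>I\<^sub>a\<close>; here it takes the value 0.\<close>

definition riesz_kernel :: "real \<Rightarrow> 'a::euclidean_space \<Rightarrow> real"
  where "riesz_kernel a x =
    Gamma ((real DIM('a) - a) / 2) / (Gamma (a / 2) * pi powr (real DIM('a) / 2) * 2 powr a)
      * norm x powr (- (real DIM('a) - a))"

text \<open>
  The convolution \<open>I\<^sub>a * f\<close>, with values in \<open>[0, \<infinity>]\<close>; it is only used for \<open>f \<ge> 0\<close> and \<open>0 < a < N\<close>,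
  so that the integrand is nonnegative and \<^const>\<open>ennreal\<close> truncates nothing.
\<close>

definition riesz_potential :: "real \<Rightarrow> ('a::euclidean_space \<Rightarrow> real) \<Rightarrow> 'a \<Rightarrow> ennreal"
  where "riesz_potential a f x = (\<integral>\<^sup>+ y. ennreal (riesz_kernel a (x - y) * f y) \<partial>lebesgue)"

definition coulomb_energy :: "real \<Rightarrow> real \<Rightarrow> ('a::euclidean_space \<Rightarrow> real) \<Rightarrow> ennreal"
  where "coulomb_energy \<alpha> p u =
    (\<integral>\<^sup>+ x. (riesz_potential (\<alpha> / 2) (\<lambda>y. \<bar>u y\<bar> powr p) x)\<^sup>2 \<partial>lebesgue)"

primrec Ck :: "nat \<Rightarrow> ('a::euclidean_space \<Rightarrow> real) \<Rightarrow> bool"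
  where
    "Ck 0 = (\<lambda>f. continuous_on UNIV f)"
  | "Ck (Suc k) = (\<lambda>f. (\<forall>x. f differentiable (at x)) \<and>
        (\<forall>i\<in>Basis. Ck k (\<lambda>x. frechet_derivative f (at x) i)))"

definition test_function :: "('a::euclidean_space \<Rightarrow> real) \<Rightarrow> bool"
  where "test_function \<phi> \<longleftrightarrow> (\<forall>k. Ck k \<phi>) \<and> compact (closure {x. \<phi> x \<noteq> 0})"

definition has_weak_gradient ::
    "('a::euclidean_space \<Rightarrow> real) \<Rightarrow> ('a \<Rightarrow> 'a) \<Rightarrow> bool"
  where "has_weak_gradient u G \<longleftrightarrow>
    (\<forall>K. compact K \<longrightarrow> u absolutely_integrable_on K \<and> G absolutely_integrable_on K) \<and>
    (\<forall>\<phi>. test_function \<phi> \<longrightarrow> (\<forall>i\<in>Basis.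
      (\<integral>x. u x * frechet_derivative \<phi> (at x) i \<partial>lebesgue) = - (\<integral>x. (G x \<bullet> i) * \<phi> x \<partial>lebesgue)))"

definition coulomb_sobolev :: "real \<Rightarrow> real \<Rightarrow> ('a::euclidean_space \<Rightarrow> real) set"
  where "coulomb_sobolev \<alpha> p = {u. u \<in> borel_measurable lebesgue \<and> coulomb_energy \<alpha> p u < \<infinity> \<and>
    (\<exists>G. has_weak_gradient u G \<and> integrable lebesgue (\<lambda>x. (norm (G x))\<^sup>2))}"

text \<open>
  The Lebesgue integral of a function of arbitrary sign as an extended real number.
  Since \<open>\<infinity> - \<infinity> = \<infinity>\<close> in \<^typ>\<open>ereal\<close>, the inequality \<open>ext_integral f < \<infinity>\<close> includes that the
  integral of \<open>f\<close> is well defined: it says that the positive part has finite integral.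
\<close>

definition ext_integral :: "('a::euclidean_space \<Rightarrow> real) \<Rightarrow> ereal"
  where "ext_integral f =
    enn2ereal (\<integral>\<^sup>+ x. ennreal (f x) \<partial>lebesgue) - enn2ereal (\<integral>\<^sup>+ x. ennreal (- f x) \<partial>lebesgue)"

end

theory Submission
  imports Defs "HOL-Real_Asymp.Real_Asymp"
begin

text \<open>
  Write \<open>w\<close> for the weight, so that \<open>W w\<close> is the integrand of the conclusion. The condition
  \<open>\<delta> > 1/2\<close> says exactly that \<open>w\<close> has finite Coulomb energy
  (\<open>log_hardy_weight_energy_finite\<close>): \<open>w(y) = |y|\<^sup>-\<^sup>\<alpha>\<^sup>/\<^sup>2 v(y)\<close>, where
  \<open>v(y) = |y|\<^sup>-\<^sup>N\<^sup>/\<^sup>2\<close> times logarithmic factors is square integrable if and only if \<open>\<delta> > 1/2\<close>, and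
  \<open>v \<mapsto> I\<^sub>\<alpha>\<^sub>/\<^sub>2 * (|y|\<^sup>-\<^sup>\<alpha>\<^sup>/\<^sup>2 v)\<close> is bounded on \<open>L\<^sup>2\<close> (\<open>stein_weiss_L2\<close>).

  If \<open>|u|\<^sup>p\<close> were equal to \<open>w\<close> on \<open>{W > 0}\<close> and to \<open>0\<close> elsewhere, then the hypothesis would bound
  the integral of the positive part of \<open>W w\<close>, because the Coulomb energy is monotone in \<open>|u|\<^sup>p\<close> and
  so at most that of \<open>w\<close>. In general such a \<open>u\<close> is not in the Coulomb--Sobolev space, as it has no
  square integrable gradient. But the gradient does not occur in the inequality of the hypothesis, so that
  any approximation by admissible functions with \<open>|u|\<^sup>p \<le> 2\<^sup>p w\<close> serves, however large their
  gradients are. Continuously differentiable functions with compact support away from the origin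
  are admissible (\<open>C1_compact_support_in_coulomb_sobolev\<close>), and products of polynomials with a fixed
  cutoff to an annulus approximate the ideal \<open>u\<close> almost everywhere on that annulus
  (\<open>polynomials_approximate_indicator_times\<close>). Dominated convergence gives a bound for the positive
  part of \<open>W w\<close> on annuli (\<open>nn_integral_cutoff_bound\<close>), uniform in the annulus, and Fatou's lemma
  removes the cutoff. In this way a weight \<open>W\<close> of variable sign, with arbitrary cancellation in
  the integrals of the hypothesis, is treated like a positive one.
\<close>

section \<open>Integrals of radial functions\<close>

lemma nn_integral_exp_atLeast:
  fixes k b :: real
  assumes "k < 0"
  shows "(\<integral>\<^sup>+t. ennreal (exp (k * t)) * indicator {b..} t \<partial>lborel) = ennreal (exp (k * b) / - k)"
proof -
  have "((\<lambda>t. exp (k * t) / k) \<longlongrightarrow> 0) at_top"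
    using assms by real_asymp
  then have "(\<integral>\<^sup>+t. ennreal (exp (k * t)) * indicator {b..} t \<partial>lborel) = ennreal (0 - exp (k * b) / k)"
    using assms by (intro nn_integral_FTC_atLeast) (auto intro!: derivative_eq_intros)
  then show ?thesis by simp
qed

lemma nn_integral_exp_atMost:
  fixes k b :: real
  assumes "0 < k"
  shows "(\<integral>\<^sup>+t. ennreal (exp (k * t)) * indicator {..b} t \<partial>lborel) = ennreal (exp (k * b) / k)"
proof -
  have "(\<integral>\<^sup>+t. ennreal (exp (k * t)) * indicator {..b} t \<partial>lborel)
      = (\<integral>\<^sup>+t. ennreal (exp (- k * t)) * indicator {- b..} t \<partial>lborel)"
    by (subst nn_integral_real_affine[where c = "-1" and t = 0])
       (auto intro!: nn_integral_cong simp: indicator_def)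
  also have "\<dots> = ennreal (exp (k * b) / k)"
    using nn_integral_exp_atLeast[of "- k" "- b"] assms by simp
  finally show ?thesis .
qed

definition sphere_area :: "'a::euclidean_space itself \<Rightarrow> real"
  where "sphere_area _ = unit_ball_vol (real DIM('a)) * real DIM('a)"

lemma sphere_area_pos: "0 < sphere_area TYPE('a::euclidean_space)"
  by (simp add: sphere_area_def)

text \<open>
  Polar coordinates, in the logarithmic radius \<open>t = ln |y|\<close>: both measures give
  \<open>{..b}\<close> the volume of the ball of radius \<open>e\<^sup>b\<close>. In this variable powers of \<open>|y|\<close> become
  exponentials and logarithmic factors lose one logarithm, so that
  all radial integrals below are evaluated by antiderivatives on half-lines.
\<close>

lemma distr_ln_norm:
  "distr lborel borel (\<lambda>y::'a::euclidean_space. ln (norm y))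
     = density lborel (\<lambda>t. ennreal (sphere_area TYPE('a) * exp (real DIM('a) * t)))"
    (is "?M = ?D")
proof (rule measure_eqI_generator_eq)
  let ?N = "real DIM('a)"
  show "Int_stable (range (\<lambda>b::real. {..b}))"
    by (auto simp: Int_stable_def)
  have M: "emeasure ?M {..b} = ennreal (unit_ball_vol ?N * exp (?N * b))" for b
  proof -
    have "emeasure ?M {..b} = emeasure lborel {y::'a. ln (norm y) \<le> b}"
      by (subst emeasure_distr) (auto simp: vimage_def)
    also have "\<dots> = emeasure lborel (cball (0::'a) (exp b))"
    proof (rule emeasure_eq_AE)
      have "AE y in lborel. y \<noteq> (0::'a)"
        by (rule AE_lborel_singleton)
      then show "AE y in lborel. (y \<in> {y::'a. ln (norm y) \<le> b}) = (y \<in> cball 0 (exp b))"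
      proof eventually_elim
        case (elim y)
        then have "0 < norm y" by simp
        then show ?case using ln_le_cancel_iff[of "norm y" "exp b"] by simp
      qed
    qed auto
    also have "\<dots> = ennreal (unit_ball_vol ?N * exp (?N * b))"
      by (simp add: emeasure_cball exp_of_nat_mult)
    finally show ?thesis .
  qed
  show "emeasure ?M X = emeasure ?D X" if "X \<in> range (\<lambda>b::real. {..b})" for X
  proof -
    from that obtain b where X: "X = {..b}" by auto
    have "emeasure ?D X = (\<integral>\<^sup>+t. ennreal (sphere_area TYPE('a)) *
        (ennreal (exp (?N * t)) * indicator {..b} t) \<partial>lborel)"
      using sphere_area_pos[where 'a = 'a] unfolding X
      by (subst emeasure_density) (auto simp: ennreal_mult mult.assoc)
    also have "\<dots> = ennreal (sphere_area TYPE('a)) * ennreal (exp (?N * b) / ?N)"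
      by (subst nn_integral_cmult) (auto simp: nn_integral_exp_atMost)
    also have "\<dots> = ennreal (unit_ball_vol ?N * exp (?N * b))"
      using sphere_area_pos[where 'a = 'a]
      by (simp add: sphere_area_def ennreal_mult[symmetric])
    finally show ?thesis using M X by simp
  qed
  show "sets ?M = sigma_sets UNIV (range (\<lambda>b::real. {..b}))"
    by (simp add: borel_eq_atMost)
  show "sets ?D = sigma_sets UNIV (range (\<lambda>b::real. {..b}))"
    by (simp add: borel_eq_atMost)
  show "range (\<lambda>n. {..real n}) \<subseteq> range (\<lambda>b::real. {..b})" by auto
  show "(\<Union>n. {..real n}) = UNIV" by (auto intro: real_arch_simple)
  show "emeasure ?M {..real n} \<noteq> \<infinity>" for n by (simp add: M)
qed auto

lemma nn_integral_radial:
  fixes h :: "real \<Rightarrow> ennreal"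
  assumes [measurable]: "h \<in> borel_measurable borel"
  shows "(\<integral>\<^sup>+y. h (ln (norm (y::'a::euclidean_space))) \<partial>lborel) =
    ennreal (sphere_area TYPE('a)) * (\<integral>\<^sup>+t. ennreal (exp (real DIM('a) * t)) * h t \<partial>lborel)"
proof -
  have "(\<integral>\<^sup>+y. h (ln (norm (y::'a))) \<partial>lborel) = (\<integral>\<^sup>+t. h t \<partial>distr lborel borel (\<lambda>y::'a. ln (norm y)))"
    by (subst nn_integral_distr) auto
  also have "\<dots> = (\<integral>\<^sup>+t. ennreal (sphere_area TYPE('a)) * (ennreal (exp (real DIM('a) * t)) * h t) \<partial>lborel)"
    using sphere_area_pos[where 'a = 'a] unfolding distr_ln_norm
    by (subst nn_integral_density) (auto simp: ennreal_mult mult.assoc)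
  also have "\<dots> = ennreal (sphere_area TYPE('a)) * (\<integral>\<^sup>+t. ennreal (exp (real DIM('a) * t)) * h t \<partial>lborel)"
    by (subst nn_integral_cmult) auto
  finally show ?thesis .
qed

lemma nn_integral_norm_powr_inside:
  fixes a r :: real
  assumes "a < real DIM('a::euclidean_space)" "0 < r"
  shows "(\<integral>\<^sup>+y. ennreal (norm (y::'a) powr - a) * indicator (cball 0 r) y \<partial>lborel)
    \<le> ennreal (sphere_area TYPE('a) / (real DIM('a) - a) * r powr (real DIM('a) - a))"
proof -
  let ?N = "real DIM('a)"
  have "(\<integral>\<^sup>+y. ennreal (norm (y::'a) powr - a) * indicator (cball 0 r) y \<partial>lborel)
      \<le> (\<integral>\<^sup>+y. ennreal (exp (- a * ln (norm (y::'a)))) * indicator {..ln r} (ln (norm y)) \<partial>lborel)"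
    using assms by (intro nn_integral_mono) (auto simp: indicator_def powr_def)
  also have "\<dots> = ennreal (sphere_area TYPE('a)) *
      (\<integral>\<^sup>+t. ennreal (exp (?N * t)) * (ennreal (exp (- a * t)) * indicator {..ln r} t) \<partial>lborel)"
    by (subst nn_integral_radial[symmetric]) auto
  also have "\<dots> = ennreal (sphere_area TYPE('a)) *
      (\<integral>\<^sup>+t. ennreal (exp ((?N - a) * t)) * indicator {..ln r} t \<partial>lborel)"
    by (intro arg_cong[where f = "(*) (ennreal (sphere_area TYPE('a)))"] nn_integral_cong)
       (simp add: mult.assoc[symmetric] ennreal_mult[symmetric] exp_add[symmetric] left_diff_distrib)
  also have "\<dots> = ennreal (sphere_area TYPE('a) / (?N - a) * r powr (?N - a))"
    using assms sphere_area_pos[where 'a = 'a]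
    by (subst nn_integral_exp_atMost) (auto simp: ennreal_mult[symmetric] powr_def)
  finally show ?thesis .
qed

lemma nn_integral_norm_powr_outside:
  fixes a r :: real
  assumes "real DIM('a::euclidean_space) < a" "0 < r"
  shows "(\<integral>\<^sup>+y. ennreal (norm (y::'a) powr - a) * indicator (- ball 0 r) y \<partial>lborel)
    \<le> ennreal (sphere_area TYPE('a) / (a - real DIM('a)) * r powr (real DIM('a) - a))"
proof -
  let ?N = "real DIM('a)"
  have "(\<integral>\<^sup>+y. ennreal (norm (y::'a) powr - a) * indicator (- ball 0 r) y \<partial>lborel)
      \<le> (\<integral>\<^sup>+y. ennreal (exp (- a * ln (norm (y::'a)))) * indicator {ln r..} (ln (norm y)) \<partial>lborel)"
    using assms by (intro nn_integral_mono) (auto simp: indicator_def powr_def)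
  also have "\<dots> = ennreal (sphere_area TYPE('a)) *
      (\<integral>\<^sup>+t. ennreal (exp (?N * t)) * (ennreal (exp (- a * t)) * indicator {ln r..} t) \<partial>lborel)"
    by (subst nn_integral_radial[symmetric]) auto
  also have "\<dots> = ennreal (sphere_area TYPE('a)) *
      (\<integral>\<^sup>+t. ennreal (exp ((?N - a) * t)) * indicator {ln r..} t \<partial>lborel)"
    by (intro arg_cong[where f = "(*) (ennreal (sphere_area TYPE('a)))"] nn_integral_cong)
       (simp add: mult.assoc[symmetric] ennreal_mult[symmetric] exp_add[symmetric] left_diff_distrib)
  also have "\<dots> = ennreal (sphere_area TYPE('a) / (a - ?N) * r powr (?N - a))"
    using assms sphere_area_pos[where 'a = 'a]
    by (subst nn_integral_exp_atLeast) (auto simp: ennreal_mult[symmetric] powr_def)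
  finally show ?thesis .
qed

lemma nn_integral_lborel_reflect:
  fixes f :: "'a::euclidean_space \<Rightarrow> ennreal"
  assumes [measurable]: "f \<in> borel_measurable borel"
  shows "(\<integral>\<^sup>+y. f (x - y) \<partial>lborel) = (\<integral>\<^sup>+y. f y \<partial>lborel)"
proof -
  have "(lborel :: 'a measure) = density (distr lborel borel (\<lambda>y. x + (-1) *\<^sub>R y)) (\<lambda>_. 1)"
    using lborel_affine[of "-1" x] by simp
  also have "\<dots> = distr lborel borel (\<lambda>y. x - y)"
    by (simp add: density_1)
  finally have "(\<integral>\<^sup>+y. f y \<partial>lborel) = (\<integral>\<^sup>+y. f y \<partial>distr lborel borel (\<lambda>y. x - y))"
    by simp
  then show ?thesis by (simp add: nn_integral_distr)
qed

section \<open>The Stein--Weiss inequality in the square integrable case\<close>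

text \<open>
  The integrand is bounded by the sum of a singularity at \<open>0\<close>, one at \<open>x\<close>, and a tail: if
  \<open>|y|\<close> and \<open>|x - y|\<close> are both larger than \<open>|x|/2\<close>, then \<open>|x - y| \<ge> |y|/3\<close>. The three
  integrals converge because of \<open>\<gamma> < N\<close>, \<open>0 < s\<close> and \<open>s < \<gamma>\<close>, respectively, and scale like
  \<open>|x|\<^sup>s\<^sup>-\<^sup>\<gamma>\<close>.
\<close>

lemma riesz_kernel_power_integral:
  fixes s \<gamma> :: real
  assumes "0 < s" "s < \<gamma>" "\<gamma> < real DIM('a::euclidean_space)"
  obtains C where "0 < C" "\<And>x::'a. x \<noteq> 0 \<Longrightarrow>
    (\<integral>\<^sup>+y. ennreal (norm (x - y) powr (s - real DIM('a)) * norm y powr - \<gamma>) \<partial>lborel)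
      \<le> ennreal (C * norm x powr (s - \<gamma>))"
proof -
  let ?N = "real DIM('a)" and ?A = "sphere_area TYPE('a)"
  note A = sphere_area_pos[where 'a = 'a]
  define D where "D = ?A / (?N - \<gamma>) + ?A / s + 3 powr (?N - s) * (?A / (\<gamma> - s))"
  have D: "0 < D"
    using assms A unfolding D_def by (intro add_pos_pos mult_pos_pos divide_pos_pos) auto
  have main: "(\<integral>\<^sup>+y. ennreal (norm (x - y) powr (s - ?N) * norm y powr - \<gamma>) \<partial>lborel)
      \<le> ennreal (D * (norm x / 2) powr (s - \<gamma>))" if "x \<noteq> 0" for x :: 'a
  proof -
    define r where "r = norm x / 2"
    have r: "0 < r" using that by (simp add: r_def)
    define near0 where "near0 y = ennreal (norm y powr - \<gamma>) * indicator (cball 0 r) y" for y :: 'a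
    define nearx where "nearx y = ennreal (norm y powr - (?N - s)) * indicator (cball 0 r) y" for y :: 'a
    define far where "far y = ennreal (norm y powr - (?N - s + \<gamma>)) * indicator (- ball 0 r) y" for y :: 'a
    have [measurable]: "cball (0::'a) r \<in> sets borel" "- ball (0::'a) r \<in> sets borel"
      by auto
    have [measurable]: "near0 \<in> borel_measurable borel" "nearx \<in> borel_measurable borel"
      "far \<in> borel_measurable borel"
      unfolding near0_def nearx_def far_def by measurable
    have split: "ennreal (norm (x - y) powr (s - ?N) * norm y powr - \<gamma>)
        \<le> ennreal (r powr (s - ?N)) * near0 y + ennreal (r powr - \<gamma>) * nearx (x - y)
          + ennreal (3 powr (?N - s)) * far y" (is "?l \<le> ?n0 + ?nx + ?f") for y
    proof -
      have tri: "norm x \<le> norm y + norm (x - y)"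
        using norm_triangle_ineq[of y "x - y"] by simp
      consider "norm y \<le> r" | "norm (x - y) \<le> r" | "r < norm y" "r < norm (x - y)"
        by linarith
      then show ?thesis
      proof cases
        case 1
        then have "r \<le> norm (x - y)" using tri by (simp add: r_def)
        then have "norm (x - y) powr (s - ?N) \<le> r powr (s - ?N)"
          using r assms by (intro powr_mono2') auto
        then have "?l \<le> ?n0"
          using 1 by (simp add: near0_def ennreal_mult[symmetric] mult_right_mono ennreal_leI)
        then show ?thesis by (simp add: add_increasing2 add.assoc)
      next
        case 2
        then have "r \<le> norm y" using tri by (simp add: r_def)
        then have "norm y powr - \<gamma> \<le> r powr - \<gamma>"
          using r assms by (intro powr_mono2') auto
        then have "?l \<le> ?nx"
          using 2 by (simp add: nearx_def ennreal_mult[symmetric] mult_right_mono ennreal_leI mult.commute)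
        then show ?thesis by (simp add: add_increasing add_increasing2)
      next
        case 3
        then have le: "norm y / 3 \<le> norm (x - y)"
          using norm_triangle_ineq4[of x "x - y"] by (simp add: r_def)
        have y: "0 < norm y" using 3 r by linarith
        have "norm (x - y) powr (s - ?N) \<le> (norm y / 3) powr (s - ?N)"
          using le y assms by (intro powr_mono2') auto
        also have "\<dots> = 3 powr (?N - s) * norm y powr (s - ?N)"
          using y by (simp add: powr_divide powr_minus_divide[of 3 "?N - s", simplified])
        finally have "norm (x - y) powr (s - ?N) * norm y powr - \<gamma>
            \<le> 3 powr (?N - s) * norm y powr (s - ?N) * norm y powr - \<gamma>"
          by (intro mult_right_mono) auto
        also have "\<dots> = 3 powr (?N - s) * norm y powr - (?N - s + \<gamma>)"
          by (simp add: mult.assoc powr_add[symmetric])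
        finally have "?l \<le> ?f"
          using 3 by (simp add: far_def ennreal_mult[symmetric] ennreal_leI)
        then show ?thesis by (simp add: add_increasing)
      qed
    qed
    have "(\<integral>\<^sup>+y. ennreal (norm (x - y) powr (s - ?N) * norm y powr - \<gamma>) \<partial>lborel)
        \<le> (\<integral>\<^sup>+y. ennreal (r powr (s - ?N)) * near0 y + ennreal (r powr - \<gamma>) * nearx (x - y)
          + ennreal (3 powr (?N - s)) * far y \<partial>lborel)"
      by (intro nn_integral_mono split)
    also have "\<dots> = ennreal (r powr (s - ?N)) * (\<integral>\<^sup>+y. near0 y \<partial>lborel)
        + ennreal (r powr - \<gamma>) * (\<integral>\<^sup>+y. nearx y \<partial>lborel)
        + ennreal (3 powr (?N - s)) * (\<integral>\<^sup>+y. far y \<partial>lborel)"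
      by (simp add: nn_integral_add nn_integral_cmult nn_integral_lborel_reflect)
    also have "\<dots> \<le> ennreal (r powr (s - ?N)) * ennreal (?A / (?N - \<gamma>) * r powr (?N - \<gamma>))
        + ennreal (r powr - \<gamma>) * ennreal (?A / (?N - (?N - s)) * r powr (?N - (?N - s)))
        + ennreal (3 powr (?N - s)) * ennreal (?A / (?N - s + \<gamma> - ?N) * r powr (?N - (?N - s + \<gamma>)))"
      unfolding near0_def nearx_def far_def
      by (intro add_mono mult_left_mono nn_integral_norm_powr_inside nn_integral_norm_powr_outside)
         (use assms r in auto)
    also have "\<dots> = ennreal (r powr (s - ?N) * (?A / (?N - \<gamma>) * r powr (?N - \<gamma>))
        + r powr - \<gamma> * (?A / s * r powr s)
        + 3 powr (?N - s) * (?A / (\<gamma> - s) * r powr (s - \<gamma>)))"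
      using assms A by (simp add: ennreal_mult[symmetric] ennreal_plus[symmetric] del: ennreal_plus)
    also have "r powr (s - ?N) * (?A / (?N - \<gamma>) * r powr (?N - \<gamma>))
        + r powr - \<gamma> * (?A / s * r powr s)
        + 3 powr (?N - s) * (?A / (\<gamma> - s) * r powr (s - \<gamma>)) = D * r powr (s - \<gamma>)"
    proof -
      have "r powr (s - ?N) * r powr (?N - \<gamma>) = r powr (s - \<gamma>)"
        "r powr - \<gamma> * r powr s = r powr (s - \<gamma>)"
        by (simp_all add: powr_add[symmetric])
      then show ?thesis
        unfolding D_def by (simp add: distrib_right mult.assoc mult.left_commute)
    qed
    finally show ?thesis by (simp add: r_def)
  qed
  show thesis
  proof (rule that)
    show "0 < D * 2 powr (\<gamma> - s)" using D by simp
    show "(\<integral>\<^sup>+y. ennreal (norm (x - y) powr (s - ?N) * norm y powr - \<gamma>) \<partial>lborel)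
        \<le> ennreal (D * 2 powr (\<gamma> - s) * norm x powr (s - \<gamma>))" if "x \<noteq> 0" for x :: 'a
    proof -
      have "(norm x / 2) powr (s - \<gamma>) = 2 powr (\<gamma> - s) * norm x powr (s - \<gamma>)"
        by (simp add: powr_divide powr_minus_divide[of 2 "\<gamma> - s", simplified])
      then show ?thesis using main[OF that] by (simp add: mult.assoc)
    qed
  qed
qed

text \<open>
  Schur's test with the weight \<open>|y|\<^sup>-\<^sup>N\<^sup>/\<^sup>2\<close>, for the kernel \<open>|x - y|\<^sup>s\<^sup>-\<^sup>N |y|\<^sup>-\<^sup>s\<close>, which is
  homogeneous of degree \<open>-N\<close>. Integrated against it in either variable, the kernel gives at most a multiple of the power that
  homogeneity dictates, by the preceding lemma with \<open>\<gamma> = s + N/2\<close> and with \<open>\<gamma> = N/2\<close>; both exponents lie between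
  \<open>s\<close> and \<open>N\<close> since \<open>2 s < N\<close>.
\<close>

lemma stein_weiss_L2:
  fixes s :: real
  assumes "0 < s" "2 * s < real DIM('a::euclidean_space)"
  obtains C where "0 < C" "\<And>v :: 'a \<Rightarrow> ennreal. v \<in> borel_measurable borel \<Longrightarrow>
    (\<integral>\<^sup>+x. (\<integral>\<^sup>+y. ennreal (norm (x - y) powr (s - real DIM('a)) * norm y powr - s) * v y \<partial>lborel)\<^sup>2 \<partial>lborel)
      \<le> ennreal C * (\<integral>\<^sup>+y. (v y)\<^sup>2 \<partial>lborel)"
proof -
  let ?N = "real DIM('a)"
  obtain C1 where C1: "0 < C1" "\<And>x::'a. x \<noteq> 0 \<Longrightarrow>
      (\<integral>\<^sup>+y. ennreal (norm (x - y) powr (s - ?N) * norm y powr - (s + ?N / 2)) \<partial>lborel)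
        \<le> ennreal (C1 * norm x powr (s - (s + ?N / 2)))"
    using riesz_kernel_power_integral[where 'a = 'a, of s "s + ?N / 2"] assms by auto
  obtain C2 where C2: "0 < C2" "\<And>y::'a. y \<noteq> 0 \<Longrightarrow>
      (\<integral>\<^sup>+x. ennreal (norm (y - x) powr (s - ?N) * norm x powr - (?N / 2)) \<partial>lborel)
        \<le> ennreal (C2 * norm y powr (s - ?N / 2))"
    using riesz_kernel_power_integral[where 'a = 'a, of s "?N / 2"] assms by auto
  show thesis
  proof (rule that)
    show "0 < C1 * C2" using C1 C2 by simp
    fix v :: "'a \<Rightarrow> ennreal"
    assume v[measurable]: "v \<in> borel_measurable borel"
    define g where "g x y = ennreal (norm (x - y) powr (s - ?N) * norm y powr (?N / 2 - s)) * (v y)\<^sup>2"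
      for x y :: 'a
    have [measurable]: "(\<lambda>(x, y). g x y) \<in> borel_measurable (borel \<Otimes>\<^sub>M borel)"
      unfolding g_def by measurable
    have CS: "(\<integral>\<^sup>+y. ennreal (norm (x - y) powr (s - ?N) * norm y powr - s) * v y \<partial>lborel)\<^sup>2
        \<le> ennreal (C1 * norm x powr - (?N / 2)) * (\<integral>\<^sup>+y. g x y \<partial>lborel)"
      if "x \<noteq> 0" for x
    proof -
      \<comment> \<open>The kernel is split evenly, with the Schur weight \<open>|y|\<^sup>-\<^sup>N\<^sup>/\<^sup>4\<close> moved to the first factor.\<close>
      let ?f = "\<lambda>y. ennreal (norm (x - y) powr ((s - ?N) / 2) * norm y powr - ((s + ?N / 2) / 2))"
      let ?h = "\<lambda>y. ennreal (norm (x - y) powr ((s - ?N) / 2) * norm y powr ((?N / 2 - s) / 2)) * v y"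
      have fh: "?f y * ?h y = ennreal (norm (x - y) powr (s - ?N) * norm y powr - s) * v y" for y
      proof -
        have "norm (x - y) powr ((s - ?N) / 2) * norm y powr - ((s + ?N / 2) / 2)
            * (norm (x - y) powr ((s - ?N) / 2) * norm y powr ((?N / 2 - s) / 2))
          = (norm (x - y) powr ((s - ?N) / 2) * norm (x - y) powr ((s - ?N) / 2))
            * (norm y powr - ((s + ?N / 2) / 2) * norm y powr ((?N / 2 - s) / 2))"
          by (simp add: mult_ac)
        also have "\<dots> = norm (x - y) powr (s - ?N) * norm y powr - s"
        proof -
          have "(s - ?N) / 2 + (s - ?N) / 2 = s - ?N"
            "- ((s + ?N / 2) / 2) + (?N / 2 - s) / 2 = - s"
            by (simp_all add: field_simps)
          then show ?thesis by (simp only: powr_add[symmetric])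
        qed
        finally show ?thesis
          by (simp add: mult.assoc[symmetric] ennreal_mult[symmetric])
      qed
      have f2: "(?f y)\<^sup>2 = ennreal (norm (x - y) powr (s - ?N) * norm y powr - (s + ?N / 2))" for y
        by (simp add: power_mult_distrib ennreal_power)
           (simp add: power2_eq_square powr_add[symmetric])
      have h2: "(?h y)\<^sup>2 = g x y" for y
        by (simp add: g_def power_mult_distrib ennreal_power)
           (simp add: power2_eq_square powr_add[symmetric])
      have "(\<integral>\<^sup>+y. ?f y * ?h y \<partial>lborel)\<^sup>2 \<le> (\<integral>\<^sup>+y. (?f y)\<^sup>2 \<partial>lborel) * (\<integral>\<^sup>+y. (?h y)\<^sup>2 \<partial>lborel)"
        by (rule Cauchy_Schwarz_nn_integral) measurable
      also have "\<dots> \<le> ennreal (C1 * norm x powr - (?N / 2)) * (\<integral>\<^sup>+y. g x y \<partial>lborel)"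
        unfolding f2 h2 using C1(2)[OF that] by (intro mult_right_mono) auto
      finally show ?thesis unfolding fh .
    qed
    have "(\<integral>\<^sup>+x. (\<integral>\<^sup>+y. ennreal (norm (x - y) powr (s - ?N) * norm y powr - s) * v y \<partial>lborel)\<^sup>2 \<partial>lborel)
        \<le> (\<integral>\<^sup>+x. ennreal (C1 * norm x powr - (?N / 2)) * (\<integral>\<^sup>+y. g x y \<partial>lborel) \<partial>lborel)"
      using AE_lborel_singleton[of "0::'a"] by (intro nn_integral_mono_AE) (auto elim!: eventually_mono intro: CS)
    also have "\<dots> = (\<integral>\<^sup>+x. (\<integral>\<^sup>+y. ennreal (C1 * norm x powr - (?N / 2)) * g x y \<partial>lborel) \<partial>lborel)"
      by (simp add: nn_integral_cmult)
    also have "\<dots> = (\<integral>\<^sup>+y. (\<integral>\<^sup>+x. ennreal (C1 * norm x powr - (?N / 2)) * g x y \<partial>lborel) \<partial>lborel)"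
    proof -
      have "(\<lambda>(x, y). ennreal (C1 * norm x powr - (?N / 2)) * g x y) \<in> borel_measurable (lborel \<Otimes>\<^sub>M lborel)"
        by measurable
      from lborel_pair.Fubini'[OF this] show ?thesis by simp
    qed
    also have "\<dots> \<le> (\<integral>\<^sup>+y. ennreal (C1 * C2) * (v y)\<^sup>2 \<partial>lborel)"
    proof (rule nn_integral_mono_AE)
      have "(\<integral>\<^sup>+x. ennreal (C1 * norm x powr - (?N / 2)) * g x y \<partial>lborel) \<le> ennreal (C1 * C2) * (v y)\<^sup>2"
        if "y \<noteq> 0" for y
      proof -
        have "(\<integral>\<^sup>+x. ennreal (C1 * norm x powr - (?N / 2)) * g x y \<partial>lborel)
            = (\<integral>\<^sup>+x. (ennreal (C1 * norm y powr (?N / 2 - s)) * (v y)\<^sup>2)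
                * ennreal (norm (y - x) powr (s - ?N) * norm x powr - (?N / 2)) \<partial>lborel)"
          using C1(1) by (intro nn_integral_cong) (simp add: g_def ennreal_mult norm_minus_commute mult_ac)
        also have "\<dots> = ennreal (C1 * norm y powr (?N / 2 - s)) * (v y)\<^sup>2
                * (\<integral>\<^sup>+x. ennreal (norm (y - x) powr (s - ?N) * norm x powr - (?N / 2)) \<partial>lborel)"
          by (rule nn_integral_cmult) measurable
        also have "\<dots> \<le> ennreal (C1 * norm y powr (?N / 2 - s)) * (v y)\<^sup>2
                * ennreal (C2 * norm y powr (s - ?N / 2))"
          by (intro mult_left_mono C2 that) auto
        also have "\<dots> = ennreal ((C1 * norm y powr (?N / 2 - s)) * (C2 * norm y powr (s - ?N / 2))) * (v y)\<^sup>2"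
          using C1(1) C2(1) by (simp add: ennreal_mult mult_ac)
        also have "(C1 * norm y powr (?N / 2 - s)) * (C2 * norm y powr (s - ?N / 2))
            = C1 * C2 * norm y powr ((?N / 2 - s) + (s - ?N / 2))"
          unfolding powr_add by (simp add: mult_ac)
        also have "\<dots> = C1 * C2" using that by simp
        finally show ?thesis .
      qed
      then show "AE y in lborel. (\<integral>\<^sup>+x. ennreal (C1 * norm x powr - (?N / 2)) * g x y \<partial>lborel)
          \<le> ennreal (C1 * C2) * (v y)\<^sup>2"
        using AE_lborel_singleton[of "0::'a"] by (auto elim!: eventually_mono)
    qed
    also have "\<dots> = ennreal (C1 * C2) * (\<integral>\<^sup>+y. (v y)\<^sup>2 \<partial>lborel)"
      by (rule nn_integral_cmult) measurable
    finally show "(\<integral>\<^sup>+x. (\<integral>\<^sup>+y. ennreal (norm (x - y) powr (s - ?N) * norm y powr - s) * v y \<partial>lborel)\<^sup>2 \<partial>lborel)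
      \<le> ennreal (C1 * C2) * (\<integral>\<^sup>+y. (v y)\<^sup>2 \<partial>lborel)" .
  qed
qed

section \<open>Finite Coulomb energy of the logarithmic weight\<close>

lemma nn_integral_inverse_log_finite:
  fixes \<delta> :: real
  assumes "1 / 2 < \<delta>"
  shows "(\<integral>\<^sup>+t. ennreal (1 / ((1 + \<bar>t\<bar>) * (1 + ln (1 + \<bar>t\<bar>)) powr (2 * \<delta>))) \<partial>lborel) < \<infinity>"
proof -
  define h where "h t = 1 / ((1 + \<bar>t\<bar>) * (1 + ln (1 + \<bar>t\<bar>)) powr (2 * \<delta>))" for t :: real
  define k where "k = 2 * \<delta> - 1"
  have k: "0 < k" "- k - 1 = - (2 * \<delta>)" using assms by (auto simp: k_def)
  define F where "F t = - ((1 + ln (1 + t)) powr - k) / k" for t :: real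
  have [measurable]: "h \<in> borel_measurable borel" unfolding h_def by measurable
  have half: "(\<integral>\<^sup>+t. ennreal (h t) * indicator {0..} t \<partial>lborel) = ennreal (0 - F 0)"
  proof (rule nn_integral_FTC_atLeast)
    show "DERIV F t :> h t" if "0 \<le> t" for t
    proof -
      have pos: "0 < 1 + ln (1 + t)" using that by (simp add: add_pos_nonneg)
      have "DERIV F t :> - (- k * (1 + ln (1 + t)) powr (- k - 1) * (1 / (1 + t))) / k"
        unfolding F_def using that pos k(1) by (auto intro!: derivative_eq_intros)
      also have "- (- k * (1 + ln (1 + t)) powr (- k - 1) * (1 / (1 + t))) / k
          = (1 + ln (1 + t)) powr - (2 * \<delta>) / (1 + t)"
        unfolding k(2) using k(1) by simp
      also have "\<dots> = h t" using that by (simp add: h_def powr_minus field_simps)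
      finally show ?thesis .
    qed
    show "(F \<longlongrightarrow> 0) at_top" unfolding F_def using k(1) by real_asymp
  qed (auto simp: h_def)
  have "(\<integral>\<^sup>+t. ennreal (h t) * indicator {..0} t \<partial>lborel)
      = (\<integral>\<^sup>+t. ennreal (h t) * indicator {0..} t \<partial>lborel)"
    by (subst nn_integral_real_affine[where c = "-1" and t = 0])
       (auto intro!: nn_integral_cong simp: indicator_def h_def)
  moreover have "(\<integral>\<^sup>+t. ennreal (h t) \<partial>lborel)
      \<le> (\<integral>\<^sup>+t. ennreal (h t) * indicator {0..} t + ennreal (h t) * indicator {..0} t \<partial>lborel)"
    by (intro nn_integral_mono) (auto simp: indicator_def)
  ultimately have "(\<integral>\<^sup>+t. ennreal (h t) \<partial>lborel) \<le> ennreal (0 - F 0) + ennreal (0 - F 0)"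
    by (simp add: nn_integral_add half)
  also have "\<dots> < \<infinity>" by simp
  finally show ?thesis by (simp add: h_def)
qed

definition log_hardy_weight :: "real \<Rightarrow> real \<Rightarrow> 'a::euclidean_space \<Rightarrow> real"
  where "log_hardy_weight \<alpha> \<delta> x = 1 / (norm x powr ((real DIM('a) + \<alpha>) / 2)
    * (1 + \<bar>ln (norm x)\<bar>) powr (1 / 2) * (1 + ln (1 + \<bar>ln (norm x)\<bar>)) powr \<delta>)"

lemma log_hardy_weight_measurable[measurable]:
  "log_hardy_weight \<alpha> \<delta> \<in> borel_measurable borel"
  unfolding log_hardy_weight_def by measurable

lemma log_hardy_weight_nonneg: "0 \<le> log_hardy_weight \<alpha> \<delta> x"
  unfolding log_hardy_weight_def by simp

lemma log_hardy_weight_pos: "x \<noteq> 0 \<Longrightarrow> 0 < log_hardy_weight \<alpha> \<delta> x"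
proof -
  assume "x \<noteq> 0"
  moreover have "0 < 1 + ln (1 + \<bar>ln (norm x)\<bar>)" by (simp add: add_pos_nonneg)
  ultimately show ?thesis
    unfolding log_hardy_weight_def by (intro divide_pos_pos mult_pos_pos) auto
qed

lemma continuous_on_log_hardy_weight:
  assumes "0 \<notin> K"
  shows "continuous_on K (log_hardy_weight \<alpha> \<delta>)"
proof -
  have pos: "0 < 1 + ln (1 + \<bar>ln (norm x)\<bar>)" for x :: 'a by (simp add: add_pos_nonneg)
  then have "1 + ln (1 + \<bar>ln (norm x)\<bar>) \<noteq> 0" for x :: 'a by (metis less_irrefl)
  moreover have "x \<noteq> 0" if "x \<in> K" for x using assms that by auto
  moreover have "1 + \<bar>ln (norm x)\<bar> \<noteq> 0" for x :: 'a by (metis abs_ge_zero add_pos_nonneg less_irrefl zero_less_one)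
  ultimately show ?thesis unfolding log_hardy_weight_def
    by (intro continuous_intros) auto
qed

text \<open>
  In the logarithmic radius the square integral of \<open>v\<close> is the integral of
  \<open>1 / ((1 + |t|) (1 + ln (1 + |t|))\<^sup>2\<^sup>\<delta>)\<close>: the factor \<open>|y|\<^sup>-\<^sup>N\<close> cancels the Jacobian.
\<close>

lemma log_hardy_weight_energy_finite:
  fixes \<alpha> \<delta> :: real
  assumes "0 < \<alpha>" "\<alpha> < real DIM('a::euclidean_space)" "1 / 2 < \<delta>"
  shows "(\<integral>\<^sup>+x. (riesz_potential (\<alpha> / 2) (log_hardy_weight \<alpha> \<delta> :: 'a \<Rightarrow> real) x)\<^sup>2 \<partial>lebesgue) < \<infinity>"
proof -
  let ?N = "real DIM('a)" and ?s = "\<alpha> / 2"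
  let ?w = "log_hardy_weight \<alpha> \<delta> :: 'a \<Rightarrow> real"
  define c where "c = Gamma ((?N - ?s) / 2) / (Gamma (?s / 2) * pi powr (?N / 2) * 2 powr ?s)"
  have c: "0 \<le> c"
    using assms unfolding c_def by (intro divide_nonneg_nonneg mult_nonneg_nonneg) (auto intro!: less_imp_le[OF Gamma_real_pos])
  define b where "b y = 1 / ((1 + \<bar>ln (norm y)\<bar>) powr (1 / 2) * (1 + ln (1 + \<bar>ln (norm y)\<bar>)) powr \<delta>)" for y :: 'a
  define v where "v y = ennreal (norm y powr - (?N / 2) * b y)" for y :: 'a
  have [measurable]: "v \<in> borel_measurable borel" unfolding v_def b_def by measurable
  have b0: "0 \<le> b y" for y by (simp add: b_def)
  have w: "?w y = norm y powr - ?s * (norm y powr - (?N / 2) * b y)" for y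
  proof -
    have "norm y powr - ((?N + \<alpha>) / 2) = norm y powr - ?s * norm y powr - (?N / 2)"
    proof -
      have "- ((?N + \<alpha>) / 2) = - ?s + - (?N / 2)" by (simp add: field_simps)
      then show ?thesis by (simp only: powr_add)
    qed
    then show ?thesis
      by (simp add: log_hardy_weight_def b_def powr_minus field_simps)
  qed
  have pot: "riesz_potential ?s ?w x = ennreal c *
      (\<integral>\<^sup>+y. ennreal (norm (x - y) powr (?s - ?N) * norm y powr - ?s) * v y \<partial>lborel)" for x
  proof -
    have "riesz_potential ?s ?w x = (\<integral>\<^sup>+y. ennreal (c * norm (x - y) powr (?s - ?N) * ?w y) \<partial>lborel)"
      by (simp add: riesz_potential_def riesz_kernel_def nn_integral_completion c_def)
    also have "\<dots> = (\<integral>\<^sup>+y. ennreal c * (ennreal (norm (x - y) powr (?s - ?N) * norm y powr - ?s) * v y) \<partial>lborel)"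
      using c b0 by (intro nn_integral_cong) (simp add: w v_def ennreal_mult mult_ac)
    finally show ?thesis by (simp add: nn_integral_cmult)
  qed
  have s: "0 < ?s" "2 * ?s < ?N" using assms by auto
  obtain C where C: "(\<integral>\<^sup>+x. (\<integral>\<^sup>+y. ennreal (norm (x - y) powr (?s - ?N) * norm y powr - ?s) * v y \<partial>lborel)\<^sup>2 \<partial>lborel)
      \<le> ennreal C * (\<integral>\<^sup>+y. (v y)\<^sup>2 \<partial>lborel)"
  proof (rule stein_weiss_L2[where 'a = 'a, OF s])
    fix C assume "\<And>v :: 'a \<Rightarrow> ennreal. v \<in> borel_measurable borel \<Longrightarrow>
      (\<integral>\<^sup>+x. (\<integral>\<^sup>+y. ennreal (norm (x - y) powr (?s - ?N) * norm y powr - ?s) * v y \<partial>lborel)\<^sup>2 \<partial>lborel)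
        \<le> ennreal C * (\<integral>\<^sup>+y. (v y)\<^sup>2 \<partial>lborel)"
    from that[OF this] show thesis by simp
  qed
  let ?h = "\<lambda>t. ennreal (1 / ((1 + \<bar>t\<bar>) * (1 + ln (1 + \<bar>t\<bar>)) powr (2 * \<delta>)))"
  have v2: "(v y)\<^sup>2 \<le> ennreal (exp (- ?N * ln (norm y))) * ?h (ln (norm y))" for y
  proof (cases "y = 0")
    case False
    have "(b y)\<^sup>2 = 1 / ((1 + \<bar>ln (norm y)\<bar>) * (1 + ln (1 + \<bar>ln (norm y)\<bar>)) powr (2 * \<delta>))"
      by (simp add: b_def power2_eq_square powr_add[symmetric] mult.assoc[symmetric]) 
         (simp add: mult.assoc powr_add[symmetric] mult.left_commute)
    moreover have "(norm y powr - (?N / 2))\<^sup>2 = exp (- ?N * ln (norm y))"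
      using False by (simp add: power2_eq_square powr_def exp_add[symmetric])
    ultimately show ?thesis
      by (simp add: v_def ennreal_power b0 power_mult_distrib ennreal_mult[symmetric])
  qed (simp add: v_def)
  have "(\<integral>\<^sup>+y. (v y)\<^sup>2 \<partial>lborel) \<le> (\<integral>\<^sup>+y. ennreal (exp (- ?N * ln (norm (y::'a)))) * ?h (ln (norm y)) \<partial>lborel)"
    by (intro nn_integral_mono v2)
  also have "\<dots> = ennreal (sphere_area TYPE('a)) *
      (\<integral>\<^sup>+t. ennreal (exp (?N * t)) * (ennreal (exp (- ?N * t)) * ?h t) \<partial>lborel)"
    by (subst nn_integral_radial[symmetric]) auto
  also have "(\<integral>\<^sup>+t. ennreal (exp (?N * t)) * (ennreal (exp (- ?N * t)) * ?h t) \<partial>lborel) = (\<integral>\<^sup>+t. ?h t \<partial>lborel)"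
    by (intro nn_integral_cong) (simp add: mult.assoc[symmetric] ennreal_mult[symmetric] exp_add[symmetric])
  finally have "(\<integral>\<^sup>+y. (v y)\<^sup>2 \<partial>lborel) < \<infinity>"
    using nn_integral_inverse_log_finite[OF assms(3)]
    by (auto simp: ennreal_mult_less_top elim!: le_less_trans)
  then have fin: "(\<integral>\<^sup>+x. (\<integral>\<^sup>+y. ennreal (norm (x - y) powr (?s - ?N) * norm y powr - ?s) * v y \<partial>lborel)\<^sup>2 \<partial>lborel) < \<infinity>"
    using C by (auto simp: ennreal_mult_less_top elim!: le_less_trans)
  have "(\<integral>\<^sup>+x. (riesz_potential ?s ?w x)\<^sup>2 \<partial>lebesgue)
      = (ennreal c)\<^sup>2 * (\<integral>\<^sup>+x. (\<integral>\<^sup>+y. ennreal (norm (x - y) powr (?s - ?N) * norm y powr - ?s) * v y \<partial>lborel)\<^sup>2 \<partial>lborel)"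
    unfolding pot power_mult_distrib nn_integral_completion
    by (rule nn_integral_cmult) measurable
  also have "\<dots> < \<infinity>" using fin c by (simp add: ennreal_mult_less_top ennreal_power)
  finally show ?thesis .
qed

lemma riesz_kernel_nonneg:
  fixes x :: "'a::euclidean_space"
  assumes "0 < s" "s < real DIM('a)"
  shows "0 \<le> riesz_kernel s x"
  using assms unfolding riesz_kernel_def
  by (intro divide_nonneg_nonneg mult_nonneg_nonneg) (auto intro!: less_imp_le[OF Gamma_real_pos])

text \<open>
  The Riesz kernel is positive, so the energy depends monotonically on \<open>|u|\<^sup>p\<close>. This is what allows
  the test functions to be switched off where \<open>W\<close> is negative.
\<close>

lemma coulomb_energy_le:
  fixes u w :: "'a::euclidean_space \<Rightarrow> real" and \<alpha> p B :: real
  assumes "0 < \<alpha>" "\<alpha> < real DIM('a)" "0 \<le> B"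
    and w[measurable]: "w \<in> borel_measurable borel" and le: "\<And>x. \<bar>u x\<bar> powr p \<le> B * w x"
  shows "coulomb_energy \<alpha> p u \<le> ennreal (B\<^sup>2) * (\<integral>\<^sup>+x. (riesz_potential (\<alpha> / 2) w x)\<^sup>2 \<partial>lebesgue)"
proof -
  have [measurable]: "(\<lambda>(x, y). riesz_kernel (\<alpha> / 2) (x - y :: 'a)) \<in> borel_measurable (borel \<Otimes>\<^sub>M borel)"
    unfolding riesz_kernel_def by measurable
  have k: "0 \<le> riesz_kernel (\<alpha> / 2) z" for z :: 'a
    using assms by (intro riesz_kernel_nonneg) auto
  have pot: "riesz_potential (\<alpha> / 2) (\<lambda>y. \<bar>u y\<bar> powr p) x \<le> ennreal B * riesz_potential (\<alpha> / 2) w x" for x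
  proof -
    have "riesz_potential (\<alpha> / 2) (\<lambda>y. \<bar>u y\<bar> powr p) x
        \<le> (\<integral>\<^sup>+y. ennreal B * ennreal (riesz_kernel (\<alpha> / 2) (x - y) * w y) \<partial>lborel)"
      unfolding riesz_potential_def nn_integral_completion
    proof (rule nn_integral_mono)
      fix y
      have "riesz_kernel (\<alpha> / 2) (x - y) * \<bar>u y\<bar> powr p \<le> B * (riesz_kernel (\<alpha> / 2) (x - y) * w y)"
        using mult_left_mono[OF le[of y] k[of "x - y"]] by (simp add: mult_ac)
      then show "ennreal (riesz_kernel (\<alpha> / 2) (x - y) * \<bar>u y\<bar> powr p)
          \<le> ennreal B * ennreal (riesz_kernel (\<alpha> / 2) (x - y) * w y)"
        using assms by (simp add: ennreal_mult'[symmetric] ennreal_leI)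
    qed
    also have "\<dots> = ennreal B * riesz_potential (\<alpha> / 2) w x"
      unfolding riesz_potential_def nn_integral_completion by (rule nn_integral_cmult) measurable
    finally show ?thesis .
  qed
  have "coulomb_energy \<alpha> p u \<le> (\<integral>\<^sup>+x. ennreal (B\<^sup>2) * (riesz_potential (\<alpha> / 2) w x)\<^sup>2 \<partial>lborel)"
    unfolding coulomb_energy_def nn_integral_completion
    using power_mono[OF pot, where n = 2] assms(3)
    by (intro nn_integral_mono) (simp add: power_mult_distrib ennreal_power)
  also have "\<dots> = ennreal (B\<^sup>2) * (\<integral>\<^sup>+x. (riesz_potential (\<alpha> / 2) w x)\<^sup>2 \<partial>lebesgue)"
    unfolding riesz_potential_def nn_integral_completion by (rule nn_integral_cmult) measurable
  finally show ?thesis .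
qed

section \<open>Smooth functions of compact support in the Coulomb--Sobolev space\<close>

text \<open>
  Continuity is asked for each directional derivative separately; in finite dimension this is the
  usual notion of a continuously differentiable function.
\<close>

definition C1_derivative :: "('a::euclidean_space \<Rightarrow> real) \<Rightarrow> ('a \<Rightarrow> 'a \<Rightarrow> real) \<Rightarrow> bool"
  where "C1_derivative f f' \<longleftrightarrow> (\<forall>x. (f has_derivative f' x) (at x)) \<and> (\<forall>v. continuous_on UNIV (\<lambda>x. f' x v))"

lemma C1_derivativeD:
  assumes "C1_derivative f f'"
  shows "(f has_derivative f' x) (at x)" "continuous_on UNIV (\<lambda>x. f' x v)" "continuous_on UNIV f"
    "bounded_linear (f' x)"
proof -
  show d: "(f has_derivative f' x) (at x)" for x
    using assms by (simp add: C1_derivative_def)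
  show "continuous_on UNIV (\<lambda>x. f' x v)"
    using assms by (simp add: C1_derivative_def)
  show "continuous_on UNIV f"
    using has_derivative_continuous[OF d] by (simp add: continuous_at_imp_continuous_on)
  show "bounded_linear (f' x)"
    using has_derivative_bounded_linear[OF d] .
qed

lemma C1_derivative_mult:
  assumes "C1_derivative f f'" "C1_derivative g g'"
  shows "C1_derivative (\<lambda>x. f x * g x) (\<lambda>x v. f x * g' x v + f' x v * g x)"
  unfolding C1_derivative_def
  using assms[THEN C1_derivativeD(1)] assms[THEN C1_derivativeD(2)] assms[THEN C1_derivativeD(3)]
  by (auto intro!: continuous_intros has_derivative_mult)

lemma C1_derivative_polynomial:
  assumes "real_polynomial_function q"
  shows "\<exists>q'. C1_derivative q q'"
  using assms
proof induction
  case (linear f)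
  then show ?case
    by (auto simp: C1_derivative_def intro!: exI[of _ "\<lambda>_. f"] bounded_linear_imp_has_derivative)
next
  case (const c)
  then show ?case
    by (auto simp: C1_derivative_def intro!: exI[of _ "\<lambda>_ _. 0"])
next
  case (add f g)
  then obtain f' g' where "C1_derivative f f'" "C1_derivative g g'" by auto
  then have "C1_derivative (\<lambda>x. f x + g x) (\<lambda>x v. f' x v + g' x v)"
    unfolding C1_derivative_def by (auto intro!: continuous_intros has_derivative_add)
  then show ?case by blast
next
  case (mult f g)
  then show ?case using C1_derivative_mult by blast
qed

lemma C1_derivative_compose:
  fixes h h' :: "real \<Rightarrow> real"
  assumes "C1_derivative f f'" "\<And>t. (h has_real_derivative h' t) (at t)" "continuous_on UNIV h'"
  shows "C1_derivative (\<lambda>x. h (f x)) (\<lambda>x v. f' x v * h' (f x))"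
  unfolding C1_derivative_def
proof (intro conjI allI)
  show "((\<lambda>x. h (f x)) has_derivative (\<lambda>v. f' x v * h' (f x))) (at x)" for x
    using has_derivative_compose[OF C1_derivativeD(1)[OF assms(1)], of h "\<lambda>v. h' (f x) * v" x]
      assms(2)[of "f x"]
    by (simp add: has_field_derivative_def mult.commute[of _ "h' (f x)"])
  show "continuous_on UNIV (\<lambda>x. f' x v * h' (f x))" for v
    by (intro continuous_intros C1_derivativeD[OF assms(1)]
        continuous_on_compose2[OF assms(3) C1_derivativeD(3)[OF assms(1)]]) auto
qed

lemma test_function_C1:
  fixes \<phi> :: "'a::euclidean_space \<Rightarrow> real"
  assumes "test_function \<phi>"
  shows "C1_derivative \<phi> (\<lambda>x. frechet_derivative \<phi> (at x))"
proof -
  have "Ck (Suc 0) \<phi>" using assms unfolding test_function_def by blast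
  then have d: "\<And>x. \<phi> differentiable (at x)"
    and c: "\<And>i. i \<in> Basis \<Longrightarrow> continuous_on UNIV (\<lambda>x. frechet_derivative \<phi> (at x) i)"
    by auto
  have fd: "(\<phi> has_derivative frechet_derivative \<phi> (at x)) (at x)" for x
    using d frechet_derivative_works by blast
  have expand: "frechet_derivative \<phi> (at x) v = (\<Sum>i\<in>Basis. (v \<bullet> i) * frechet_derivative \<phi> (at x) i)" for x v
  proof -
    interpret bounded_linear "frechet_derivative \<phi> (at x)"
      using fd has_derivative_bounded_linear by blast
    have "frechet_derivative \<phi> (at x) v = frechet_derivative \<phi> (at x) (\<Sum>i\<in>Basis. (v \<bullet> i) *\<^sub>R i)"
      by (simp add: euclidean_representation)
    then show ?thesis by (simp add: sum scale)
  qed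
  have "continuous_on UNIV (\<lambda>x. frechet_derivative \<phi> (at x) v)" for v
    unfolding expand[of _ v] by (intro continuous_intros c)
  with fd show ?thesis by (simp add: C1_derivative_def)
qed

lemma C1_derivative_zero_outside:
  assumes "C1_derivative f f'" "\<And>x. x \<notin> K \<Longrightarrow> f x = 0" "closed K" "x \<notin> K"
  shows "f' x v = 0"
proof -
  have "open (- K)" "x \<in> - K" using assms by auto
  moreover have "((\<lambda>_. 0) has_derivative (\<lambda>_. 0)) (at x)" by simp
  ultimately have "(f has_derivative (\<lambda>_. 0)) (at x)"
    using assms(2) by (auto intro: has_derivative_transform_within_open[of "\<lambda>_. 0" _ x UNIV "- K"])
  then show ?thesis
    using has_derivative_unique[OF _ C1_derivativeD(1)[OF assms(1)], of "\<lambda>_. 0" x] by (metis)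
qed

lemma integrable_continuous_compact_support:
  fixes f :: "'a::euclidean_space \<Rightarrow> 'b::euclidean_space"
  assumes "continuous_on UNIV f" "compact K" "\<And>x. x \<notin> K \<Longrightarrow> f x = 0"
  shows "integrable lborel f"
proof -
  have "integrable lborel (\<lambda>x. indicator K x *\<^sub>R f x)"
    using assms by (intro borel_integrable_compact) (auto intro: continuous_on_subset)
  also have "(\<lambda>x. indicator K x *\<^sub>R f x) = f"
    using assms by (auto simp: indicator_def fun_eq_iff)
  finally show ?thesis .
qed

text \<open>
  By translation invariance all difference quotients of \<open>f\<close> have integral zero. They are bounded by
  the maximum of the derivative on a common compact set, so the limit can be taken under the
  integral.
\<close>

lemma integral_directional_derivative_eq_0:
  fixes f :: "'a::euclidean_space \<Rightarrow> real"
  assumes f: "C1_derivative f f'" and K: "compact K" "\<And>x. x \<notin> K \<Longrightarrow> f x = 0"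
  shows "(\<integral>x. f' x v \<partial>lborel) = 0"
proof -
  define t where "t n = inverse (real (Suc n))" for n
  have t: "0 < t n" "t n \<le> 1" for n by (auto simp: t_def field_simps)
  have t_lim: "t \<longlonglongrightarrow> 0" unfolding t_def by (rule LIMSEQ_inverse_real_of_nat)
  define D where "D n x = (f (t n *\<^sub>R v + x) - f x) / t n" for n x
  define K' where "K' = (\<lambda>(x, r). x - r *\<^sub>R v) ` (K \<times> {0..1})"
  have K': "compact K'"
    unfolding K'_def by (intro compact_continuous_image compact_Times K) (auto intro!: continuous_intros simp: case_prod_unfold)
  have in_K': "x \<in> K'" if "r *\<^sub>R v + x \<in> K" "r \<in> {0..1}" for x r
    unfolding K'_def using that by (intro image_eqI[of _ _ "(r *\<^sub>R v + x, r)"]) auto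
  have KK': "K \<subseteq> K'" using in_K'[of 0] by auto
  have f'0: "f' x v = 0" if "x \<notin> K" for x
    using C1_derivative_zero_outside[OF f K(2) compact_imp_closed[OF K(1)] that] .
  have "bounded ((\<lambda>x. f' x v) ` K)"
    by (intro compact_imp_bounded compact_continuous_image K continuous_on_subset[OF C1_derivativeD(2)[OF f]]) auto
  then obtain B where "\<And>x. x \<in> K \<Longrightarrow> \<bar>f' x v\<bar> \<le> B" "0 < B"
    unfolding bounded_pos by auto
  then have B: "\<bar>f' x v\<bar> \<le> B" for x using f'0[of x] by (cases "x \<in> K") auto
  have int_f: "integrable lborel f"
    by (rule integrable_continuous_compact_support[OF C1_derivativeD(3)[OF f] K])
  have int_shift: "integrable lborel (\<lambda>x. f (t n *\<^sub>R v + x))" for n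
  proof -
    have "integrable (distr lborel borel ((+) (t n *\<^sub>R v))) f" using int_f by (simp add: lborel_distr_plus)
    then show ?thesis using int_f by (subst (asm) integrable_distr_eq) auto
  qed
  have D0: "(\<integral>x. D n x \<partial>lborel) = 0" for n
  proof -
    have "(\<integral>x. f (t n *\<^sub>R v + x) \<partial>lborel) = (\<integral>x. f x \<partial>distr lborel borel ((+) (t n *\<^sub>R v)))"
      using C1_derivativeD(3)[OF f]
      by (subst integral_distr) (auto intro: borel_measurable_continuous_onI)
    then show ?thesis unfolding D_def using int_f int_shift by (simp add: lborel_distr_plus)
  qed
  have bound: "\<bar>D n x\<bar> \<le> indicator K' x *\<^sub>R B" for n x
  proof (cases "x \<in> K'")
    case True
    have der: "((\<lambda>r. f (x + r *\<^sub>R v)) has_real_derivative f' (x + r *\<^sub>R v) v) (at r)" for r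
    proof -
      have "((\<lambda>r. x + r *\<^sub>R v) has_derivative (\<lambda>h. h *\<^sub>R v)) (at r)"
        by (auto intro!: derivative_eq_intros)
      from has_derivative_compose[OF this C1_derivativeD(1)[OF f]]
      have "((\<lambda>r. f (x + r *\<^sub>R v)) has_derivative (\<lambda>h. f' (x + r *\<^sub>R v) (h *\<^sub>R v))) (at r)" .
      moreover have "f' (x + r *\<^sub>R v) (h *\<^sub>R v) = f' (x + r *\<^sub>R v) v * h" for h
        using C1_derivativeD(4)[OF f] by (simp add: linear_simps(5) mult.commute)
      ultimately show ?thesis by (simp add: has_field_derivative_def mult.commute[of _ "f' _ v"] fun_eq_iff)
    qed
    obtain z where "f (x + t n *\<^sub>R v) - f (x + 0 *\<^sub>R v) = (t n - 0) * f' (x + z *\<^sub>R v) v"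
      using MVT2[of 0 "t n", OF t(1), of "\<lambda>r. f (x + r *\<^sub>R v)" "\<lambda>r. f' (x + r *\<^sub>R v) v"] der by blast
    then have "D n x = f' (x + z *\<^sub>R v) v"
      using t(1)[of n] by (simp add: D_def add.commute field_simps)
    then show ?thesis using B True by simp
  next
    case False
    have "t n *\<^sub>R v + x \<notin> K" using in_K'[of "t n" x] t[of n] False by auto
    then show ?thesis using False KK' K(2) by (auto simp: D_def)
  qed
  have lim: "(\<lambda>n. D n x) \<longlonglongrightarrow> f' x v" for x
  proof -
    have "((\<lambda>r. x + r *\<^sub>R v) has_derivative (\<lambda>h. h *\<^sub>R v)) (at 0)"
      by (auto intro!: derivative_eq_intros)
    from has_derivative_compose[OF this] C1_derivativeD(1)[OF f, of x]
    have "((\<lambda>r. f (x + r *\<^sub>R v)) has_derivative (\<lambda>h. f' x (h *\<^sub>R v))) (at 0)" by simp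
    moreover have "f' x (h *\<^sub>R v) = f' x v * h" for h
      using C1_derivativeD(4)[OF f] by (simp add: linear_simps(5) mult.commute)
    ultimately have "((\<lambda>r. f (x + r *\<^sub>R v)) has_real_derivative f' x v) (at 0)"
      by (simp add: has_field_derivative_def)
    then have "((\<lambda>h. (f (x + h *\<^sub>R v) - f x) / h) \<longlongrightarrow> f' x v) (at 0)"
      by (simp add: DERIV_def)
    moreover have "filterlim t (at 0) sequentially"
      using t_lim t(1) by (auto simp: filterlim_at less_imp_neq[symmetric] intro!: always_eventually)
    ultimately have "(\<lambda>n. (f (x + t n *\<^sub>R v) - f x) / t n) \<longlonglongrightarrow> f' x v"
      by (rule filterlim_compose)
    then show ?thesis by (simp add: D_def add.commute)
  qed
  have "(\<lambda>n. \<integral>x. D n x \<partial>lborel) \<longlonglongrightarrow> (\<integral>x. f' x v \<partial>lborel)"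
  proof (rule integral_dominated_convergence)
    show "(\<lambda>x. f' x v) \<in> borel_measurable lborel"
      using C1_derivativeD(2)[OF f] by (auto intro: borel_measurable_continuous_onI)
    show "D n \<in> borel_measurable lborel" for n
      unfolding D_def using int_f int_shift by measurable
    show "integrable lborel (\<lambda>x. indicator K' x *\<^sub>R B)"
      using borel_integrable_compact[OF K', of "\<lambda>_. B"] by simp
  qed (use lim bound in auto)
  then show ?thesis using D0 by (simp add: LIMSEQ_const_iff)
qed

text \<open>
  Integration by parts: the preceding lemma applied to the product with a test function.
\<close>

lemma C1_compact_support_has_weak_gradient:
  fixes u :: "'a::euclidean_space \<Rightarrow> real"
  assumes u: "C1_derivative u u'" and K: "compact K" "\<And>x. x \<notin> K \<Longrightarrow> u x = 0"
  defines "G \<equiv> \<lambda>x. \<Sum>i\<in>Basis. u' x i *\<^sub>R i"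
  shows "has_weak_gradient u G" "integrable lebesgue (\<lambda>x. (norm (G x))\<^sup>2)"
proof -
  have cG: "continuous_on UNIV G"
    unfolding G_def by (intro continuous_intros C1_derivativeD(2)[OF u])
  have G0: "G x = 0" if "x \<notin> K" for x
    unfolding G_def
    using C1_derivative_zero_outside[OF u K(2) compact_imp_closed[OF K(1)] that] by simp
  have "integrable lborel (\<lambda>x. (norm (G x))\<^sup>2)"
    using G0 by (intro integrable_continuous_compact_support[OF _ K(1)] continuous_intros cG) auto
  then show "integrable lebesgue (\<lambda>x. (norm (G x))\<^sup>2)"
    by (subst integrable_completion) auto
  have ai: "f absolutely_integrable_on L" if "compact L" "continuous_on UNIV f"
    for f :: "'a \<Rightarrow> 'c::euclidean_space" and L
  proof -
    have "integrable lborel (\<lambda>x. indicator L x *\<^sub>R f x)"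
      using that by (intro borel_integrable_compact) (auto intro: continuous_on_subset)
    then show ?thesis
      unfolding set_integrable_def by (subst integrable_completion) auto
  qed
  show "has_weak_gradient u G"
    unfolding has_weak_gradient_def
  proof (intro conjI allI impI ballI)
    fix \<phi> :: "'a \<Rightarrow> real" and i :: 'a
    assume \<phi>: "test_function \<phi>" and i: "i \<in> Basis"
    let ?\<phi>' = "\<lambda>x. frechet_derivative \<phi> (at x)"
    note \<phi>' = test_function_C1[OF \<phi>]
    note [continuous_intros] = C1_derivativeD(2,3)[OF \<phi>'] C1_derivativeD(2,3)[OF u]
    have Gi: "G x \<bullet> i = u' x i" for x
      unfolding G_def using i by (simp add: inner_sum_left inner_Basis if_distrib cong: if_cong)
    have u'0: "u' x i = 0" if "x \<notin> K" for x
      using G0[OF that] Gi[of x] by simp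
    have I: "integrable lborel (\<lambda>x. u x * ?\<phi>' x i)" "integrable lborel (\<lambda>x. u' x i * \<phi> x)"
      using K(2) u'0
      by (auto intro!: integrable_continuous_compact_support[OF _ K(1)] continuous_intros)
    have "(\<integral>x. u x * ?\<phi>' x i + u' x i * \<phi> x \<partial>lborel) = 0"
      by (rule integral_directional_derivative_eq_0[OF C1_derivative_mult[OF u \<phi>'] K(1)]) (simp add: K(2))
    with I have "(\<integral>x. u x * ?\<phi>' x i \<partial>lborel) = - (\<integral>x. u' x i * \<phi> x \<partial>lborel)"
      by simp
    moreover have "(\<integral>x. u x * ?\<phi>' x i \<partial>lebesgue) = (\<integral>x. u x * ?\<phi>' x i \<partial>lborel)"
      "(\<integral>x. u' x i * \<phi> x \<partial>lebesgue) = (\<integral>x. u' x i * \<phi> x \<partial>lborel)"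
      using I by (auto intro!: integral_completion)
    ultimately show "(\<integral>x. u x * ?\<phi>' x i \<partial>lebesgue) = - (\<integral>x. (G x \<bullet> i) * \<phi> x \<partial>lebesgue)"
      unfolding Gi by simp
  qed (use ai cG C1_derivativeD(3)[OF u] in auto)
qed

text \<open>
  The support stays away from the origin, where the weight is not continuous; on it the weight is
  bounded below, so that \<open>|u|\<^sup>p\<close> is at most a multiple of the weight and its energy is finite.
\<close>

lemma C1_compact_support_in_coulomb_sobolev:
  fixes u :: "'a::euclidean_space \<Rightarrow> real"
  assumes "0 < \<alpha>" "\<alpha> < real DIM('a)" "0 < p"
    and u: "C1_derivative u u'" and K: "compact K" "0 \<notin> K" "\<And>x. x \<notin> K \<Longrightarrow> u x = 0"
  shows "u \<in> coulomb_sobolev \<alpha> p"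
proof -
  let ?w = "log_hardy_weight \<alpha> 1 :: 'a \<Rightarrow> real"
  have cu: "continuous_on K u" by (rule continuous_on_subset[OF C1_derivativeD(3)[OF u]]) simp
  have w: "0 < ?w x" if "x \<in> K" for x
    using that K(2) by (intro log_hardy_weight_pos) auto
  then have "continuous_on K (\<lambda>x. \<bar>u x\<bar> powr p / ?w x)"
    using assms(3) less_imp_neq[OF w]
    by (intro continuous_intros continuous_on_powr' cu continuous_on_log_hardy_weight K(2)) auto
  then have "bounded ((\<lambda>x. \<bar>u x\<bar> powr p / ?w x) ` K)"
    by (intro compact_imp_bounded compact_continuous_image K)
  then obtain B where B: "0 < B" "\<And>x. x \<in> K \<Longrightarrow> \<bar>\<bar>u x\<bar> powr p / ?w x\<bar> \<le> B"
    unfolding bounded_pos by auto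
  have "\<bar>u x\<bar> powr p \<le> B * ?w x" for x
  proof (cases "x \<in> K")
    case True
    then show ?thesis using B(2)[OF True] w[OF True] by (simp add: pos_divide_le_eq)
  next
    case False
    then show ?thesis using K(3) B(1) assms(3) by (simp add: log_hardy_weight_nonneg)
  qed
  then have "coulomb_energy \<alpha> p u \<le> ennreal (B\<^sup>2) * (\<integral>\<^sup>+x. (riesz_potential (\<alpha> / 2) ?w x)\<^sup>2 \<partial>lebesgue)"
    using assms B by (intro coulomb_energy_le) auto
  also have "\<dots> < \<infinity>"
    using log_hardy_weight_energy_finite[where 'a = 'a, of \<alpha> 1] assms by (simp add: ennreal_mult_less_top)
  finally have "coulomb_energy \<alpha> p u < \<infinity>" .
  moreover have "u \<in> borel_measurable lebesgue"
    using C1_derivativeD(3)[OF u] by (simp add: borel_measurable_continuous_onI measurable_completion)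
  ultimately show ?thesis
    using C1_compact_support_has_weak_gradient[OF u K(1,3)] unfolding coulomb_sobolev_def by blast
qed

section \<open>Test functions concentrated on the positivity set\<close>

text \<open>
  The indicator is an almost everywhere limit of continuous functions with values in \<open>[0, 1]\<close>. Their
  products with \<open>M\<close> are replaced by polynomials with an error that tends to zero and
  never exceeds the minimum of \<open>M\<close>; this is why the bound by \<open>2 M\<close> survives.
\<close>

lemma polynomials_approximate_indicator_times:
  fixes S K :: "'a::euclidean_space set" and M :: "'a \<Rightarrow> real"
  assumes S: "S \<in> sets lebesgue" and K: "compact K"
    and M: "continuous_on K M" "\<And>x. x \<in> K \<Longrightarrow> 0 < M x"
  obtains q where "\<And>n::nat. real_polynomial_function (q n)"
    "\<And>n x. x \<in> K \<Longrightarrow> \<bar>q n x\<bar> \<le> 2 * M x"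
    "AE x in lebesgue. x \<in> K \<longrightarrow> (\<lambda>n. q n x) \<longlonglongrightarrow> indicator S x * M x"
proof -
  obtain m where m: "0 < m" "\<And>x. x \<in> K \<Longrightarrow> m \<le> M x"
  proof (cases "K = {}")
    case True
    then show thesis using that[of 1] by simp
  next
    case False
    then obtain x where "x \<in> K" "\<And>y. y \<in> K \<Longrightarrow> M x \<le> M y"
      using continuous_attains_inf[OF K _ M(1)] by blast
    then show thesis using that[of "M x"] M(2) by blast
  qed
  have "(indicator S :: 'a \<Rightarrow> real) measurable_on UNIV"
    using S by (intro lebesgue_measurable_imp_measurable_on_real) auto
  then obtain Z g where Z: "negligible Z" and g: "\<And>n. continuous_on UNIV (g n)"
    and g_lim: "\<And>x. x \<notin> Z \<Longrightarrow> (\<lambda>n. g n x) \<longlonglongrightarrow> (indicator S x :: real)"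
    unfolding measurable_on_def by auto
  define c where "c n x = max 0 (min 1 (g n x))" for n x
  define e where "e n = m * inverse (real (Suc n))" for n
  have e: "0 < e n" "e n \<le> m" for n using m(1) by (auto simp: e_def field_simps)
  have e_lim: "e \<longlonglongrightarrow> 0"
    unfolding e_def using tendsto_mult_right_zero[OF LIMSEQ_inverse_real_of_nat] by simp
  have "\<exists>q. real_polynomial_function q \<and> (\<forall>x\<in>K. \<bar>c n x * M x - q x\<bar> < e n)" for n
  proof -
    have "continuous_on K (\<lambda>x. c n x * M x)"
      unfolding c_def by (intro continuous_intros M continuous_on_subset[OF g]) auto
    then show ?thesis
      by (rule Stone_Weierstrass_real_polynomial_function[OF K _ e(1)]) auto
  qed
  then obtain q where q: "\<And>n. real_polynomial_function (q n)"
    "\<And>n x. x \<in> K \<Longrightarrow> \<bar>c n x * M x - q n x\<bar> < e n" by metis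
  show thesis
  proof (rule that[OF q(1)])
    show "\<bar>q n x\<bar> \<le> 2 * M x" if x: "x \<in> K" for n x
    proof -
      have "0 \<le> c n x" "c n x \<le> 1" by (auto simp: c_def)
      then have "0 \<le> c n x * M x" "c n x * M x \<le> M x"
        using M(2)[OF x] by (auto simp: mult_left_le_one_le)
      then show ?thesis using q(2)[OF x, of n] e(2)[of n] m(2)[OF x] by linarith
    qed
    have "(\<lambda>n. q n x) \<longlonglongrightarrow> indicator S x * M x" if x: "x \<in> K" "x \<notin> Z" for x
    proof -
      have "(\<lambda>n. c n x) \<longlonglongrightarrow> max 0 (min 1 (indicator S x))"
        unfolding c_def by (intro tendsto_intros g_lim x)
      then have "(\<lambda>n. c n x * M x) \<longlonglongrightarrow> indicator S x * M x"
        by (cases "x \<in> S") (auto dest: tendsto_mult[OF _ tendsto_const[of "M x"]])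
      moreover have "(\<lambda>n. c n x * M x - q n x) \<longlonglongrightarrow> 0"
        by (rule Lim_null_comparison[OF _ e_lim]) (use q(2)[OF x(1)] in \<open>auto intro!: always_eventually less_imp_le\<close>)
      ultimately show ?thesis
        using tendsto_diff by fastforce
    qed
    moreover have "AE x in lebesgue. x \<notin> Z"
      using Z by (simp add: negligible_iff_null_sets AE_not_in)
    ultimately show "AE x in lebesgue. x \<in> K \<longrightarrow> (\<lambda>n. q n x) \<longlonglongrightarrow> indicator S x * M x"
      by (auto elim!: eventually_mono)
  qed
qed

text \<open>
  A continuously differentiable cutoff that is positive exactly in the interior of an annulus, growing
  to \<open>\<real>\<^sup>N - {0}\<close> with \<open>j\<close>. It is not normalised; the quotient by the majorant below
  has values in \<open>[0, 1]\<close> and tends to 1. The squared norm is used in place of the norm to keep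
  the expressions polynomial.
\<close>

definition annulus_cutoff :: "real \<Rightarrow> 'a::euclidean_space \<Rightarrow> real"
  where "annulus_cutoff j x = (max 0 (j * (x \<bullet> x) - (1 + (x \<bullet> x)\<^sup>2)))\<^sup>2"

definition annulus_majorant :: "real \<Rightarrow> 'a::euclidean_space \<Rightarrow> real"
  where "annulus_majorant j x = (j * (x \<bullet> x) + (1 + (x \<bullet> x)\<^sup>2))\<^sup>2"

lemma annulus_cutoff_nonneg: "0 \<le> annulus_cutoff j x"
  by (simp add: annulus_cutoff_def)

lemma annulus_majorant_pos:
  assumes "0 \<le> j"
  shows "0 < annulus_majorant j x"
proof -
  have "0 < j * (x \<bullet> x) + (1 + (x \<bullet> x)\<^sup>2)"
    using assms by (intro add_nonneg_pos add_pos_nonneg) auto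
  then show ?thesis by (simp add: annulus_majorant_def)
qed

lemma annulus_cutoff_le_majorant:
  assumes "0 \<le> j"
  shows "annulus_cutoff j x \<le> annulus_majorant j x"
  unfolding annulus_cutoff_def annulus_majorant_def
proof (rule power_mono)
  have "0 \<le> j * (x \<bullet> x)" "0 \<le> (x \<bullet> x)\<^sup>2" using assms by auto
  then show "max 0 (j * (x \<bullet> x) - (1 + (x \<bullet> x)\<^sup>2)) \<le> j * (x \<bullet> x) + (1 + (x \<bullet> x)\<^sup>2)"
    by linarith
qed simp

lemma annulus_ratio_tendsto:
  fixes x :: "'a::euclidean_space"
  assumes "x \<noteq> 0"
  shows "(\<lambda>n. annulus_cutoff (real n) x / annulus_majorant (real n) x) \<longlonglongrightarrow> 1"
proof -
  have t: "0 < x \<bullet> x" using assms by simp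
  then show ?thesis unfolding annulus_cutoff_def annulus_majorant_def by real_asymp
qed

definition annulus :: "real \<Rightarrow> 'a::euclidean_space set"
  where "annulus j = {x. 1 + (x \<bullet> x)\<^sup>2 \<le> j * (x \<bullet> x)}"

lemma zero_notin_annulus: "0 \<notin> annulus j"
  by (simp add: annulus_def)

lemma annulus_cutoff_eq_0: "x \<notin> annulus j \<Longrightarrow> annulus_cutoff j x = 0"
  by (simp add: annulus_def annulus_cutoff_def)

lemma compact_annulus:
  assumes "0 \<le> j"
  shows "compact (annulus j :: 'a::euclidean_space set)"
proof -
  have "norm x \<le> j + 1" if "x \<in> annulus j" for x :: 'a
  proof (rule ccontr)
    assume "\<not> norm x \<le> j + 1"
    then have n: "j + 1 < norm x" by simp
    then have "norm x * 1 \<le> norm x * norm x" using assms by (intro mult_left_mono) auto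
    then have "j < x \<bullet> x" using n by (simp add: dot_square_norm power2_eq_square)
    then have "j * (x \<bullet> x) \<le> (x \<bullet> x)\<^sup>2"
      using assms by (simp add: power2_eq_square mult_right_mono)
    with that show False by (simp add: annulus_def)
  qed
  then have "bounded (annulus j :: 'a set)" unfolding bounded_iff by blast
  moreover have "closed (annulus j :: 'a set)"
    unfolding annulus_def by (intro closed_Collect_le continuous_intros)
  ultimately show ?thesis by (simp add: compact_eq_bounded_closed)
qed

lemma has_real_derivative_positive_part_square:
  "((\<lambda>t::real. (max 0 t)\<^sup>2) has_real_derivative 2 * max 0 t) (at t)"
proof -
  have eq: "(\<lambda>t::real. (max 0 t)\<^sup>2) = (\<lambda>t. (t\<^sup>2 + t * \<bar>t\<bar>) / 2)"
    by (auto simp: fun_eq_iff max_def power2_eq_square abs_if)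
  have "((\<lambda>t::real. t * \<bar>t\<bar>) has_real_derivative 2 * \<bar>t\<bar>) (at t)"
  proof (cases "t = 0")
    case True
    have "(\<lambda>h::real. (h * \<bar>h\<bar>) / h) = (\<lambda>h. \<bar>h\<bar>)" by auto
    moreover have "((\<lambda>h::real. \<bar>h\<bar>) \<longlongrightarrow> \<bar>0\<bar>) (at 0)" by (intro tendsto_intros)
    ultimately have "((\<lambda>h::real. (h * \<bar>h\<bar>) / h) \<longlongrightarrow> 0) (at 0)"
      by simp
    then show ?thesis using True by (simp add: DERIV_def)
  next
    case False
    then consider "t < 0" | "0 < t" by linarith
    then show ?thesis
    proof cases
      case 1
      have "((\<lambda>t::real. - (t\<^sup>2)) has_real_derivative 2 * \<bar>t\<bar>) (at t)"
        using 1 by (auto intro!: derivative_eq_intros)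
      then show ?thesis
        using 1 by (auto simp: power2_eq_square
          intro: has_field_derivative_transform_within_open[where S = "{..<0}"])
    next
      case 2
      have "((\<lambda>t::real. t\<^sup>2) has_real_derivative 2 * \<bar>t\<bar>) (at t)"
        using 2 by (auto intro!: derivative_eq_intros)
      then show ?thesis
        using 2 by (auto simp: power2_eq_square
          intro: has_field_derivative_transform_within_open[where S = "{0<..}"])
    qed
  qed
  moreover have "((\<lambda>t::real. t\<^sup>2) has_real_derivative 2 * t) (at t)"
    by (auto intro!: derivative_eq_intros)
  ultimately have "((\<lambda>t::real. (t\<^sup>2 + t * \<bar>t\<bar>) / 2) has_real_derivative (2 * t + 2 * \<bar>t\<bar>) / 2) (at t)"
    by (intro DERIV_cdivide DERIV_add)
  also have "(2 * t + 2 * \<bar>t\<bar>) / 2 = 2 * max 0 t" by (simp add: max_def)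
  finally show ?thesis unfolding eq .
qed

lemma C1_annulus_cutoff: "\<exists>z'. C1_derivative (annulus_cutoff j :: 'a::euclidean_space \<Rightarrow> real) z'"
proof -
  have sq: "C1_derivative (\<lambda>x::'a. x \<bullet> x) (\<lambda>x v. 2 * (x \<bullet> v))"
    unfolding C1_derivative_def
    by (auto intro!: derivative_eq_intros continuous_intros simp: inner_commute)
  have der: "((\<lambda>t. (max 0 (j * t - (1 + t\<^sup>2)))\<^sup>2) has_real_derivative
      2 * max 0 (j * t - (1 + t\<^sup>2)) * (j - 2 * t)) (at t)" for t
    by (rule DERIV_chain2[OF has_real_derivative_positive_part_square])
       (auto intro!: derivative_eq_intros)
  have "continuous_on UNIV (\<lambda>t. 2 * max 0 (j * t - (1 + t\<^sup>2)) * (j - 2 * t))"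
    by (intro continuous_intros)
  from C1_derivative_compose[OF sq der this] show ?thesis
    unfolding annulus_cutoff_def by blast
qed

text \<open>
  The test functions are \<open>\<zeta> q\<^sub>n\<close> with the cutoff \<open>\<zeta>\<close>, its majorant \<open>d\<close>, and polynomials
  \<open>q\<^sub>n\<close> approximating \<open>w\<^sup>1\<^sup>/\<^sup>p / d\<close> on \<open>{W > 0}\<close> and \<open>0\<close> elsewhere. Since \<open>\<zeta> \<le> d\<close>, their \<open>p\<close>-th
  powers are at most \<open>2\<^sup>p w\<close>, whatever \<open>j\<close> is, hence a bound that does not depend on \<open>j\<close>. The
  conclusion concerns the positive part only, as \<^const>\<open>ennreal\<close> maps negative numbers to 0.
\<close>

lemma nn_integral_cutoff_bound:
  fixes W :: "'a::euclidean_space \<Rightarrow> real" and \<alpha> p \<delta> j :: real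
  defines "w \<equiv> log_hardy_weight \<alpha> \<delta> :: 'a \<Rightarrow> real"
  defines "E \<equiv> \<integral>\<^sup>+x. (riesz_potential (\<alpha> / 2) w x)\<^sup>2 \<partial>lebesgue"
  defines "F \<equiv> \<lambda>x. ennreal (W x * w x * (annulus_cutoff j x / annulus_majorant j x) powr p)"
  assumes \<alpha>: "0 < \<alpha>" "\<alpha> < real DIM('a)" and p: "0 < p" and \<delta>: "1 / 2 < \<delta>" and j: "0 \<le> j"
    and W: "\<forall>u \<in> coulomb_sobolev \<alpha> p.
           integrable lebesgue (\<lambda>x. W x * \<bar>u x\<bar> powr p) \<and>
           (\<integral>x. W x * \<bar>u x\<bar> powr p \<partial>lebesgue) \<le> sqrt (enn2real (coulomb_energy \<alpha> p u))"
  shows "F \<in> borel_measurable lebesgue"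
    "(\<integral>\<^sup>+x. F x \<partial>lebesgue) \<le> ennreal (sqrt (enn2real (ennreal ((2 powr p)\<^sup>2) * E)))"
proof -
  let ?K = "annulus j :: 'a set" and ?z = "annulus_cutoff j :: 'a \<Rightarrow> real" and ?d = "annulus_majorant j :: 'a \<Rightarrow> real"
  note K = compact_annulus[where 'a = 'a, OF j] zero_notin_annulus[where 'a = 'a, of j]
  have d: "0 < ?d x" for x by (rule annulus_majorant_pos[OF j])
  have z: "0 \<le> ?z x" "?z x \<le> ?d x" for x
    by (rule annulus_cutoff_nonneg, rule annulus_cutoff_le_majorant[OF j])
  have w: "0 < w x" if "x \<in> ?K" for x
    unfolding w_def using that K(2) by (intro log_hardy_weight_pos) auto
  have w0: "0 \<le> w x" for x by (simp add: w_def log_hardy_weight_nonneg)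
  have [measurable]: "w \<in> borel_measurable borel" unfolding w_def by measurable
  obtain z' where z': "C1_derivative ?z z'" using C1_annulus_cutoff by blast
  have [measurable]: "?d \<in> borel_measurable borel" "?z \<in> borel_measurable borel"
    unfolding annulus_majorant_def annulus_cutoff_def by measurable
  have admissible: "(\<lambda>x. ?z x * q x) \<in> coulomb_sobolev \<alpha> p" if q: "real_polynomial_function q" for q
  proof -
    obtain q' where "C1_derivative q q'" using C1_derivative_polynomial[OF q] by blast
    from C1_derivative_mult[OF z' this] show ?thesis
      by (rule C1_compact_support_in_coulomb_sobolev[OF \<alpha> p _ K]) (simp add: annulus_cutoff_eq_0)
  qed
  \<comment> \<open>The hypothesis for the cutoff itself makes \<open>W\<close> measurable where the cutoff is positive,
    and it provides the dominating function below.\<close>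
  have Wz: "integrable lebesgue (\<lambda>x. W x * ?z x powr p)"
  proof -
    have "?z \<in> coulomb_sobolev \<alpha> p" using admissible[of "\<lambda>_. 1"] by auto
    then show ?thesis using W z(1) by fastforce
  qed
  then have [measurable]: "(\<lambda>x. W x * ?z x powr p) \<in> borel_measurable lebesgue" by simp
  define S where "S = {x. 0 < W x * ?z x powr p}"
  have S: "S \<in> sets lebesgue"
  proof -
    have "{x \<in> space lebesgue. 0 < W x * ?z x powr p} \<in> sets lebesgue" by measurable
    then show ?thesis by (simp add: S_def)
  qed
  define M where "M x = w x powr (1 / p) / ?d x" for x
  have M: "0 < M x" if "x \<in> ?K" for x using w[OF that] d by (simp add: M_def)
  have "continuous_on ?K M"
    unfolding M_def w_def annulus_majorant_def
    using less_imp_neq[OF w, unfolded w_def] less_imp_neq[OF d, unfolded annulus_majorant_def]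
    by (intro continuous_intros continuous_on_log_hardy_weight K) auto
  then obtain q where q: "\<And>n. real_polynomial_function (q n)"
    "\<And>n x. x \<in> ?K \<Longrightarrow> \<bar>q n x\<bar> \<le> 2 * M x"
    and q_lim: "AE x in lebesgue. x \<in> ?K \<longrightarrow> (\<lambda>n. q n x) \<longlonglongrightarrow> indicator S x * M x"
    by (rule polynomials_approximate_indicator_times[OF S K(1) _ M]) auto
  have zM: "(?z x * M x) powr p = w x * (?z x / ?d x) powr p" for x
  proof -
    have "(?z x * M x) powr p = (w x powr (1 / p) * (?z x / ?d x)) powr p"
      by (simp add: M_def mult_ac)
    also have "\<dots> = w x * (?z x / ?d x) powr p"
      using p z(1)[of x] d[of x] w0[of x] by (subst powr_mult) (auto simp: powr_powr)
    finally show ?thesis .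
  qed
  have u_le: "\<bar>?z x * q n x\<bar> powr p \<le> 2 powr p * w x" for n x
  proof (cases "x \<in> ?K")
    case True
    have "\<bar>?z x * q n x\<bar> \<le> 2 * (?z x * M x)"
      using mult_left_mono[OF q(2)[OF True, of n] z(1)[of x]] z(1)[of x] by (simp add: abs_mult mult_ac)
    then have "\<bar>?z x * q n x\<bar> powr p \<le> (2 * (?z x * M x)) powr p"
      using p by (intro powr_mono2) auto
    also have "\<dots> = 2 powr p * (w x * (?z x / ?d x) powr p)"
      unfolding zM[symmetric] using z(1)[of x] M[OF True] by (intro powr_mult)
    also have "\<dots> \<le> 2 powr p * (w x * 1)"
      using z[of x] d[of x] w0[of x] p by (intro mult_left_mono powr_le1) auto
    finally show ?thesis by simp
  next
    case False
    then show ?thesis using p w0 by (simp add: annulus_cutoff_eq_0)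
  qed
  define B where "B = sqrt (enn2real (ennreal ((2 powr p)\<^sup>2) * E))"
  have E: "E < \<infinity>"
    unfolding E_def w_def by (rule log_hardy_weight_energy_finite[OF \<alpha> \<delta>])
  have int_le: "(\<integral>x. W x * \<bar>?z x * q n x\<bar> powr p \<partial>lebesgue) \<le> B" for n
  proof -
    have "coulomb_energy \<alpha> p (\<lambda>x. ?z x * q n x) \<le> ennreal ((2 powr p)\<^sup>2) * E"
      unfolding E_def by (rule coulomb_energy_le[OF \<alpha> _ _ u_le]) auto
    then have "sqrt (enn2real (coulomb_energy \<alpha> p (\<lambda>x. ?z x * q n x))) \<le> B"
      unfolding B_def using E by (intro real_sqrt_le_mono enn2real_mono) (auto simp: ennreal_mult_less_top)
    then show ?thesis using W admissible[OF q(1)] by (meson order_trans)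
  qed
  define L where "L x = indicator S x * (W x * (w x * (?z x / ?d x) powr p))" for x
  have L: "(\<lambda>x. W x * (w x * (?z x / ?d x) powr p)) \<in> borel_measurable lebesgue"
  proof -
    have "(\<lambda>x. (W x * ?z x powr p) * (w x / ?d x powr p)) \<in> borel_measurable lebesgue"
    proof (rule borel_measurable_times)
      have "(\<lambda>x. w x / ?d x powr p) \<in> borel_measurable lborel" by measurable
      then show "(\<lambda>x. w x / ?d x powr p) \<in> borel_measurable lebesgue"
        by (rule measurable_completion)
    qed fact
    also have "(\<lambda>x. (W x * ?z x powr p) * (w x / ?d x powr p)) = (\<lambda>x. W x * (w x * (?z x / ?d x) powr p))"
      using z(1) d by (intro ext) (simp add: powr_divide less_imp_le)
    finally show ?thesis .
  qed
  then show "F \<in> borel_measurable lebesgue"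
    unfolding F_def by (simp add: mult.assoc)
  have [measurable]: "L \<in> borel_measurable lebesgue"
    unfolding L_def using L S by measurable
  have "bounded (M ` ?K)"
    using \<open>continuous_on ?K M\<close> by (intro compact_imp_bounded compact_continuous_image K)
  then obtain b where b: "0 < b" "\<And>x. x \<in> ?K \<Longrightarrow> \<bar>M x\<bar> \<le> b"
    unfolding bounded_pos by auto
  have *: "L \<in> borel_measurable lebesgue" "\<And>n. (\<lambda>x. W x * \<bar>?z x * q n x\<bar> powr p) \<in> borel_measurable lebesgue"
    "integrable lebesgue (\<lambda>x. \<bar>W x * ?z x powr p\<bar> * (2 * b) powr p)"
    "AE x in lebesgue. (\<lambda>n. W x * \<bar>?z x * q n x\<bar> powr p) \<longlonglongrightarrow> L x"
    "\<And>n. AE x in lebesgue. norm (W x * \<bar>?z x * q n x\<bar> powr p) \<le> \<bar>W x * ?z x powr p\<bar> * (2 * b) powr p"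
  proof -
    show "(\<lambda>x. W x * \<bar>?z x * q n x\<bar> powr p) \<in> borel_measurable lebesgue" for n
      using W admissible[OF q(1)] borel_measurable_integrable by blast
    show "integrable lebesgue (\<lambda>x. \<bar>W x * ?z x powr p\<bar> * (2 * b) powr p)"
      by (intro integrable_mult_left integrable_abs Wz)
    show "AE x in lebesgue. norm (W x * \<bar>?z x * q n x\<bar> powr p) \<le> \<bar>W x * ?z x powr p\<bar> * (2 * b) powr p" for n
    proof (rule AE_I2)
      fix x
      show "norm (W x * \<bar>?z x * q n x\<bar> powr p) \<le> \<bar>W x * ?z x powr p\<bar> * (2 * b) powr p"
      proof (cases "x \<in> ?K")
        case True
        have "\<bar>q n x\<bar> \<le> 2 * b" using q(2)[OF True, of n] b(2)[OF True] by linarith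
        then have "\<bar>q n x\<bar> powr p \<le> (2 * b) powr p" using p by (intro powr_mono2) auto
        then have "\<bar>W x\<bar> * ?z x powr p * \<bar>q n x\<bar> powr p \<le> \<bar>W x\<bar> * ?z x powr p * (2 * b) powr p"
          by (intro mult_left_mono) auto
        then show ?thesis using z(1)[of x] by (simp add: abs_mult powr_mult mult_ac)
      qed (simp add: annulus_cutoff_eq_0)
    qed
    show "AE x in lebesgue. (\<lambda>n. W x * \<bar>?z x * q n x\<bar> powr p) \<longlonglongrightarrow> L x"
      using q_lim
    proof eventually_elim
      case (elim x)
      show ?case
      proof (cases "x \<in> ?K")
        case True
        then have "(\<lambda>n. \<bar>?z x * q n x\<bar>) \<longlonglongrightarrow> \<bar>?z x * (indicator S x * M x)\<bar>"
          using elim by (intro tendsto_intros) auto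
        then have "(\<lambda>n. W x * \<bar>?z x * q n x\<bar> powr p) \<longlonglongrightarrow> W x * \<bar>?z x * (indicator S x * M x)\<bar> powr p"
          using p by (intro tendsto_mult tendsto_const tendsto_powr') auto
        also have "W x * \<bar>?z x * (indicator S x * M x)\<bar> powr p = L x"
          using z(1)[of x] M[OF True] p by (cases "x \<in> S") (auto simp: L_def zM)
        finally show ?thesis .
      next
        case False
        then show ?thesis using p by (simp add: annulus_cutoff_eq_0 L_def)
      qed
    qed
  qed fact
  have L_int: "integrable lebesgue L"
    by (rule integrable_dominated_convergence[OF *])
  have "(\<lambda>n. \<integral>x. W x * \<bar>?z x * q n x\<bar> powr p \<partial>lebesgue) \<longlonglongrightarrow> (\<integral>x. L x \<partial>lebesgue)"
    by (rule integral_dominated_convergence[OF *])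
  then have L_le: "(\<integral>x. L x \<partial>lebesgue) \<le> B"
    by (rule LIMSEQ_le_const2) (use int_le in auto)
  have L0: "0 \<le> L x" for x
    using w0[of x] by (auto simp: L_def S_def indicator_def zero_less_mult_iff)
  have "F x = ennreal (L x)" for x
  proof (cases "x \<in> S")
    case True
    then show ?thesis by (simp add: F_def L_def mult.assoc)
  next
    case False
    then have "W x \<le> 0 \<or> ?z x = 0" using z(1)[of x] by (auto simp: S_def zero_less_mult_iff not_less)
    then have "W x * w x * (?z x / ?d x) powr p \<le> 0"
      using w0[of x] p by (auto simp: mult_nonpos_nonneg)
    then show ?thesis using False by (simp add: F_def L_def ennreal_neg)
  qed
  then have "(\<integral>\<^sup>+x. F x \<partial>lebesgue) = ennreal (\<integral>x. L x \<partial>lebesgue)"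
    using nn_integral_eq_integral[OF L_int] L0 by simp
  also have "\<dots> \<le> ennreal B" using L_le by (rule ennreal_leI)
  finally show "(\<integral>\<^sup>+x. F x \<partial>lebesgue) \<le> ennreal (sqrt (enn2real (ennreal ((2 powr p)\<^sup>2) * E)))"
    by (simp add: B_def)
qed

theorem proposition3p5:
  fixes W :: "real ^ 'n \<Rightarrow> real" and \<alpha> p \<delta> :: real
  assumes "0 < \<alpha>" and "\<alpha> < real CARD('n)" and "1 \<le> p"
    and "\<forall>u \<in> coulomb_sobolev \<alpha> p.
           integrable lebesgue (\<lambda>x. W x * \<bar>u x\<bar> powr p) \<and>
           (\<integral>x. W x * \<bar>u x\<bar> powr p \<partial>lebesgue) \<le> sqrt (enn2real (coulomb_energy \<alpha> p u))"
    and "\<delta> > 1 / 2"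
  shows "ext_integral (\<lambda>x. W x /
           (norm x powr ((real CARD('n) + \<alpha>) / 2)
             * (1 + \<bar>ln (norm x)\<bar>) powr (1 / 2)
             * (1 + ln (1 + \<bar>ln (norm x)\<bar>)) powr \<delta>)) < \<infinity>"
proof -
  let ?w = "log_hardy_weight \<alpha> \<delta> :: real ^ 'n \<Rightarrow> real"
  let ?r = "\<lambda>n x :: real ^ 'n. annulus_cutoff (real n) x / annulus_majorant (real n) x"
  define F where "F n x = ennreal (W x * ?w x * ?r n x powr p)" for n and x :: "real ^ 'n"
  have \<alpha>: "0 < \<alpha>" "\<alpha> < real DIM(real ^ 'n)" and p: "0 < p" using assms by auto
  note cutoff = nn_integral_cutoff_bound[OF \<alpha> p assms(5) of_nat_0_le_iff assms(4)]
  have meas: "F n \<in> borel_measurable lebesgue" for n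
    unfolding F_def by (rule cutoff(1))
  obtain B where bound: "\<And>n. (\<integral>\<^sup>+x. F n x \<partial>lebesgue) \<le> ennreal B"
    unfolding F_def using cutoff(2) that by fast
  \<comment> \<open>At the origin the weight has the value \<open>1 / 0 = 0\<close>, so all terms vanish there.\<close>
  have lim: "(\<lambda>n. F n x) \<longlonglongrightarrow> ennreal (W x * ?w x)" for x
  proof (cases "x = 0")
    case False
    have "(\<lambda>n. W x * ?w x * ?r n x powr p) \<longlonglongrightarrow> W x * ?w x * 1 powr p"
      using annulus_ratio_tendsto[OF False] by (intro tendsto_intros) auto
    then show ?thesis unfolding F_def by (intro tendsto_ennrealI) simp
  qed (simp add: F_def log_hardy_weight_def)
  have "(\<integral>\<^sup>+x. ennreal (W x * ?w x) \<partial>lebesgue) = (\<integral>\<^sup>+x. liminf (\<lambda>n. F n x) \<partial>lebesgue)"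
    by (intro nn_integral_cong lim_imp_Liminf[symmetric] lim) simp
  also have "\<dots> \<le> liminf (\<lambda>n. \<integral>\<^sup>+x. F n x \<partial>lebesgue)"
    by (rule nn_integral_liminf) (rule meas)
  also have "\<dots> \<le> ennreal B"
    by (rule Liminf_le) (use bound in auto)
  also have "\<dots> < \<infinity>" by simp
  finally have fin: "(\<integral>\<^sup>+x. ennreal (W x * ?w x) \<partial>lebesgue) < \<infinity>" .
  have eq: "(\<lambda>x. W x / (norm x powr ((real CARD('n) + \<alpha>) / 2)
      * (1 + \<bar>ln (norm x)\<bar>) powr (1 / 2) * (1 + ln (1 + \<bar>ln (norm x)\<bar>)) powr \<delta>)) = (\<lambda>x. W x * ?w x)"
    by (simp add: log_hardy_weight_def)
  show ?thesis
    unfolding ext_integral_def eq using fin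
    by (cases "\<integral>\<^sup>+x. ennreal (W x * ?w x) \<partial>lebesgue"; cases "\<integral>\<^sup>+x. ennreal (- (W x * ?w x)) \<partial>lebesgue") auto
qed

end
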